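(* Let $Q:\mathbb{C}\to\mathbb{R}$ be $C^2$-smooth and satisfy $Q(z)\ge(1+\epsilon)\log|z|^2$ for $|z|\ge C_0$, for some positive numbers $\epsilon,C_0$. Then there exists a constant $C$, depending only on $Q$, such that for all $z\in\mathbb{C}$, all real $m\ge1$ and all positive integers $n\le m$, $$K_{2,mQ,n}(z,z)\,e^{-mQ(z)}\le C\,m^2\,e^{-m(Q(z)-\widehat Q(z))}.$$
   Context: Notation: $dA(z)=\pi^{-1}\,dx\,dy$. $L^2(e^{-mQ})$ is the space of measurable functions on $\mathbb{C}$ that are square-integrable with respect to $e^{-mQ}\,dA$. For an integer $n\ge1$ and real $m>0$, $\mathrm{Pol}_{2,n}=\operatorname{span}_{\mathbb{C}}\{\bar z^r z^j: 0\le r\le 1,\ 0\le j\le n-1\}$ and $A^2_{2,mQ,n}=\mathrm{Pol}_{2,n}\cap L^2(e^{-mQ})$, a finite-dimensional subspace of $L^2(e^{-mQ})$. $K_{2,mQ,n}$ is its reproducing kernel: $K_{2,mQ,n}(z,w)=\sum_j e_j(z)\overline{e_j(w)}$ for any orthonormal basis $(e_j)$ of $A^2_{2,mQ,n}$. The equilibrium weight $\widehat Q$ is the largest subharmonic function on $\mathbb{C}$ that is $\le Q$ everywhere and satisfies $\widehat Q(z)=\log|z|^2+O(1)$ as $|z|\to\infty$. *)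

theory Defs
  imports "HOL-Analysis.Analysis"
begin

text \<open>Twice continuously (Frechet) differentiable, with \<open>\<complex>\<close> regarded as a real vector space.\<close>

definition C2_smooth :: "(complex \<Rightarrow> real) \<Rightarrow> bool" where
  "C2_smooth Q \<longleftrightarrow>
     (\<exists>(Q' :: complex \<Rightarrow> complex \<Rightarrow>\<^sub>L real) (Q'' :: complex \<Rightarrow> complex \<Rightarrow>\<^sub>L (complex \<Rightarrow>\<^sub>L real)).
        (\<forall>z. (Q has_derivative blinfun_apply (Q' z)) (at z)) \<and>
        (\<forall>z. (Q' has_derivative blinfun_apply (Q'' z)) (at z)) \<and>
        continuous_on UNIV Q'')"


subsection \<open>The weighted space of bianalytic polynomials and its kernel\<close>

definition dA :: "complex measure" where
  "dA = density lborel (\<lambda>_. ennreal (1 / pi))"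

definition weighted_dA :: "real \<Rightarrow> (complex \<Rightarrow> real) \<Rightarrow> complex measure" where
  "weighted_dA m Q = density dA (\<lambda>z. ennreal (exp (- m * Q z)))"

text \<open>The elements are functions rather than classes modulo null sets. This makes no
  difference below, where only continuous functions are considered.\<close>

definition L2 :: "complex measure \<Rightarrow> (complex \<Rightarrow> complex) set" where
  "L2 M = {f \<in> borel_measurable M. integrable M (\<lambda>z. (cmod (f z))\<^sup>2)}"

definition L2_inner :: "complex measure \<Rightarrow> (complex \<Rightarrow> complex) \<Rightarrow> (complex \<Rightarrow> complex) \<Rightarrow> complex" where
  "L2_inner M f g = (\<integral>z. f z * cnj (g z) \<partial>M)"

definition Pol2 :: "nat \<Rightarrow> (complex \<Rightarrow> complex) set" where
  "Pol2 n = {f. \<exists>c. f = (\<lambda>z. \<Sum>r\<in>{0..1::nat}. \<Sum>j<n. c r j * (cnj z ^ r * z ^ j))}"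

definition A2 :: "real \<Rightarrow> (complex \<Rightarrow> real) \<Rightarrow> nat \<Rightarrow> (complex \<Rightarrow> complex) set" where
  "A2 m Q n = Pol2 n \<inter> L2 (weighted_dA m Q)"

definition orthonormal_basis ::
    "complex measure \<Rightarrow> (complex \<Rightarrow> complex) set \<Rightarrow> nat \<Rightarrow> (nat \<Rightarrow> complex \<Rightarrow> complex) \<Rightarrow> bool" where
  "orthonormal_basis M A d e \<longleftrightarrow>
     (\<forall>j<d. e j \<in> A) \<and>
     (\<forall>i<d. \<forall>j<d. L2_inner M (e i) (e j) = (if i = j then 1 else 0)) \<and>
     (\<forall>f\<in>A. \<exists>c. f = (\<lambda>z. \<Sum>j<d. c j * e j z))"

text \<open>The kernel is the common value of the sum over all orthonormal bases. For continuous
  \<open>Q\<close>, lemmas \<open>orthonormal_basis_exists\<close> and \<open>K2_eq\<close> below justify the definite description.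
  On the diagonal the sum is \<open>\<Sum>j<d. (cmod (e j z))\<^sup>2\<close>, hence real.\<close>

definition K2 :: "real \<Rightarrow> (complex \<Rightarrow> real) \<Rightarrow> nat \<Rightarrow> complex \<Rightarrow> complex \<Rightarrow> complex" where
  "K2 m Q n z w =
     (THE k. \<exists>d e. orthonormal_basis (weighted_dA m Q) (A2 m Q n) d e \<and>
                   k = (\<Sum>j<d. e j z * cnj (e j w)))"

locale function_inner_space =
  fixes M :: "complex measure" and A :: "(complex \<Rightarrow> complex) set"
  assumes zero_mem: "(\<lambda>_. 0) \<in> A"
    and add_mem: "\<And>f g c. f \<in> A \<Longrightarrow> g \<in> A \<Longrightarrow> (\<lambda>z. f z + c * g z) \<in> A"
    and integrable_mult: "\<And>f g. f \<in> A \<Longrightarrow> g \<in> A \<Longrightarrow> integrable M (\<lambda>z. f z * cnj (g z))"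
    and definite: "\<And>f. f \<in> A \<Longrightarrow> L2_inner M f f = 0 \<Longrightarrow> f = (\<lambda>_. 0)"
begin

lemma scale_mem: "g \<in> A \<Longrightarrow> (\<lambda>z. c * g z) \<in> A"
  using add_mem[OF zero_mem, of g c] by simp

lemma sum_mem: "(\<And>j. j < (d::nat) \<Longrightarrow> e j \<in> A) \<Longrightarrow> (\<lambda>z. \<Sum>j<d. c j * e j z) \<in> A"
proof (induction d)
  case 0
  then show ?case using zero_mem by simp
next
  case (Suc d)
  then show ?case using add_mem[of "\<lambda>z. \<Sum>j<d. c j * e j z" "e d" "c d"] by simp
qed

lemma inner_add:
  assumes "f \<in> A" "g \<in> A" "h \<in> A"
  shows "L2_inner M (\<lambda>z. f z + c * g z) h = L2_inner M f h + c * L2_inner M g h"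
proof -
  have "L2_inner M (\<lambda>z. f z + c * g z) h = (\<integral>z. f z * cnj (h z) + c * (g z * cnj (h z)) \<partial>M)"
    unfolding L2_inner_def by (simp add: algebra_simps)
  also have "\<dots> = (\<integral>z. f z * cnj (h z) \<partial>M) + (\<integral>z. c * (g z * cnj (h z)) \<partial>M)"
    by (intro Bochner_Integration.integral_add integrable_mult_right integrable_mult assms)
  finally show ?thesis unfolding L2_inner_def by simp
qed

lemma inner_zero: "L2_inner M (\<lambda>_. 0) h = 0"
  by (simp add: L2_inner_def)

lemma inner_scale:
  assumes "g \<in> A" "h \<in> A"
  shows "L2_inner M (\<lambda>z. c * g z) h = c * L2_inner M g h"
  using inner_add[OF zero_mem assms, of c] by (simp add: inner_zero)

lemma inner_cnj: "L2_inner M g f = cnj (L2_inner M f g)"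
proof -
  have "cnj (L2_inner M f g) = (\<integral>z. cnj (f z * cnj (g z)) \<partial>M)"
    unfolding L2_inner_def by (rule Bochner_Integration.integral_cnj[symmetric])
  then show ?thesis by (simp add: L2_inner_def mult.commute)
qed

lemma inner_sum:
  assumes "\<And>j. j < (d::nat) \<Longrightarrow> e j \<in> A" "h \<in> A"
  shows "L2_inner M (\<lambda>z. \<Sum>j<d. c j * e j z) h = (\<Sum>j<d. c j * L2_inner M (e j) h)"
  using assms(1)
proof (induction d)
  case 0
  then show ?case by (simp add: inner_zero)
next
  case (Suc d)
  then show ?case
    using inner_add[OF sum_mem[of d e c], of "e d" h "c d"] assms(2) by simp
qed

lemma basis_expansion:
  assumes "orthonormal_basis M A d e" "f \<in> A"
  shows "f = (\<lambda>z. \<Sum>j<d. L2_inner M f (e j) * e j z)"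
proof -
  obtain c where c: "f = (\<lambda>z. \<Sum>j<d. c j * e j z)"
    using assms unfolding orthonormal_basis_def by blast
  have "L2_inner M f (e k) = c k" if "k < d" for k
  proof -
    have "L2_inner M f (e k) = (\<Sum>j<d. c j * L2_inner M (e j) (e k))"
      unfolding c using assms(1) that by (intro inner_sum) (auto simp: orthonormal_basis_def)
    also have "\<dots> = (\<Sum>j<d. if j = k then c j else 0)"
      using assms(1) that by (intro sum.cong) (auto simp: orthonormal_basis_def)
    finally show ?thesis using that by simp
  qed
  then show ?thesis using c by (metis (no_types, lifting) lessThan_iff sum.cong)
qed

lemma kernel_unique:
  assumes e: "orthonormal_basis M A d e" and f: "orthonormal_basis M A d' f"
  shows "(\<Sum>j<d. e j z * cnj (e j w)) = (\<Sum>k<d'. f k z * cnj (f k w))"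
proof -
  have eA: "e j \<in> A" if "j < d" for j using e that by (auto simp: orthonormal_basis_def)
  have fA: "f k \<in> A" if "k < d'" for k using f that by (auto simp: orthonormal_basis_def)
  let ?a = "\<lambda>j k. L2_inner M (e j) (f k)"
  have "(\<Sum>j<d. e j z * cnj (e j w)) = (\<Sum>j<d. (\<Sum>k<d'. ?a j k * f k z) * cnj (e j w))"
    using basis_expansion[OF f eA] by (intro sum.cong refl) (metis lessThan_iff)
  also have "\<dots> = (\<Sum>k<d'. f k z * (\<Sum>j<d. ?a j k * cnj (e j w)))"
    unfolding sum_distrib_right sum_distrib_left
    by (subst sum.swap) (simp add: mult_ac)
  also have "\<dots> = (\<Sum>k<d'. f k z * cnj (f k w))"
  proof (intro sum.cong refl)
    fix k assume "k \<in> {..<d'}"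
    then have "f k w = (\<Sum>j<d. L2_inner M (f k) (e j) * e j w)"
      using fun_cong[OF basis_expansion[OF e fA[of k]], of w] by simp
    then have "cnj (f k w) = (\<Sum>j<d. ?a j k * cnj (e j w))"
      by (simp add: inner_cnj[of "f k"])
    then show "f k z * (\<Sum>j<d. ?a j k * cnj (e j w)) = f k z * cnj (f k w)" by simp
  qed
  finally show ?thesis .
qed

end

lemma orthonormal_basis_exists_aux:
  assumes "function_inner_space M A"
    and "\<And>f. f \<in> A \<Longrightarrow> \<exists>c. f = (\<lambda>z. \<Sum>i<(N::nat). c i * g i z)"
  shows "\<exists>d e. orthonormal_basis M A d e"
  using assms
proof (induction N arbitrary: A)
  case 0
  then have "orthonormal_basis M A 0 (\<lambda>_ _. 0)"
    by (auto simp: orthonormal_basis_def)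
  then show ?case by blast
next
  case (Suc N)
  interpret function_inner_space M A by fact
  define B where "B = A \<inter> {f. \<exists>c. f = (\<lambda>z. \<Sum>i<N. c i * g i z)}"
  have B_add: "(\<lambda>z. f z + c * h z) \<in> B" if fB: "f \<in> B" and hB: "h \<in> B" for f h c
  proof -
    obtain a where a: "f = (\<lambda>z. \<Sum>i<N. a i * g i z)"
      using fB unfolding B_def by blast
    obtain b where b: "h = (\<lambda>z. \<Sum>i<N. b i * g i z)"
      using hB unfolding B_def by blast
    have "(\<lambda>z. f z + c * h z) = (\<lambda>z. \<Sum>i<N. (a i + c * b i) * g i z)"
      unfolding a b by (simp add: sum.distrib sum_distrib_left algebra_simps)
    then have "\<exists>p. (\<lambda>z. f z + c * h z) = (\<lambda>z. \<Sum>i<N. p i * g i z)"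
      by (rule exI[of _ "\<lambda>i. a i + c * b i"])
    moreover have "(\<lambda>z. f z + c * h z) \<in> A"
      using fB hB by (auto simp: B_def intro: add_mem)
    ultimately show ?thesis unfolding B_def by simp
  qed
  have "\<exists>p. (\<lambda>z. 0) = (\<lambda>z. \<Sum>i<N. p i * g i z)"
    by (rule exI[of _ "\<lambda>_. 0"]) simp
  then have B_zero: "(\<lambda>z. 0) \<in> B" unfolding B_def using zero_mem by simp
  have BI: "function_inner_space M B"
    by unfold_locales (use B_zero B_add integrable_mult definite in \<open>auto simp: B_def\<close>)
  interpret B: function_inner_space M B by (rule BI)
  obtain d e where e: "orthonormal_basis M B d e"
    using Suc.IH[OF BI] by (auto simp: B_def)
  show ?case
  proof (cases "A \<subseteq> B")
    case True
    then have "A = B" by (auto simp: B_def)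
    then show ?thesis using e by auto
  next
    case False
    then obtain f where f: "f \<in> A" "f \<notin> B" by blast
    have eB: "e j \<in> B" if "j < d" for j using e that by (auto simp: orthonormal_basis_def)
    then have eA: "e j \<in> A" if "j < d" for j using that by (auto simp: B_def)
    define s where "s = (\<lambda>z. \<Sum>j<d. L2_inner M f (e j) * e j z)"
    define h where "h = (\<lambda>z. f z + (-1) * s z)"
    have sB: "s \<in> B" unfolding s_def using eB by (rule B.sum_mem)
    then have sA: "s \<in> A" by (auto simp: B_def)
    have hA: "h \<in> A" unfolding h_def using f sA by (intro add_mem)
    have "h \<noteq> (\<lambda>_. 0)"
    proof
      assume "h = (\<lambda>_. 0)"
      then have "f = s" by (auto simp: h_def fun_eq_iff)
      with f sB show False by simp
    qed
    then have h0: "L2_inner M h h \<noteq> 0" using definite[OF hA] by blast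
    have hh: "L2_inner M h h = of_real (\<integral>z. (cmod (h z))\<^sup>2 \<partial>M)"
      unfolding L2_inner_def complex_norm_square[symmetric] by (rule integral_complex_of_real)
    define a where "a = (\<integral>z. (cmod (h z))\<^sup>2 \<partial>M)"
    have "a \<ge> 0" unfolding a_def by (rule integral_nonneg_AE) auto
    moreover have "a \<noteq> 0" using h0 hh a_def by auto
    ultimately have a: "a > 0" by simp
    have he: "L2_inner M h (e k) = 0" if "k < d" for k
    proof -
      have "L2_inner M s (e k) = (\<Sum>j<d. L2_inner M f (e j) * L2_inner M (e j) (e k))"
        unfolding s_def using eA that by (intro inner_sum) auto
      also have "\<dots> = (\<Sum>j<d. if j = k then L2_inner M f (e j) else 0)"
        using e that by (intro sum.cong) (auto simp: orthonormal_basis_def)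
      finally have "L2_inner M s (e k) = L2_inner M f (e k)" using that by simp
      then show ?thesis
        unfolding h_def using inner_add[OF f(1) sA eA[OF that], of "-1"] by simp
    qed
    define u where "u = (\<lambda>z. complex_of_real (1 / sqrt a) * h z)"
    have uA: "u \<in> A" unfolding u_def using hA by (rule scale_mem)
    have ue: "L2_inner M u (e k) = 0" if "k < d" for k
      unfolding u_def inner_scale[OF hA eA[OF that]] he[OF that] by simp
    have eu: "L2_inner M (e k) u = 0" if "k < d" for k
      using ue[OF that] inner_cnj[of "e k" u] by simp
    have "L2_inner M u u = complex_of_real (1 / sqrt a) * cnj (complex_of_real (1 / sqrt a) * L2_inner M h h)"
      using inner_scale[OF hA uA, of "complex_of_real (1 / sqrt a)", folded u_def]
        inner_scale[OF hA hA, of "complex_of_real (1 / sqrt a)", folded u_def]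
        inner_cnj[of h u] by (simp only:)
    also have "\<dots> = complex_of_real (1 / sqrt a * (1 / sqrt a * a))"
      unfolding hh a_def[symmetric] by (simp only: of_real_mult complex_cnj_mult complex_cnj_complex_of_real)
    also have "1 / sqrt a * (1 / sqrt a * a) = 1"
      using a by (simp add: field_simps)
    finally have uu: "L2_inner M u u = 1" by simp
    have fu: "f z = complex_of_real (sqrt a) * u z + s z" for z
      using a by (simp add: u_def h_def)
    obtain p where p: "f = (\<lambda>z. \<Sum>i<Suc N. p i * g i z)" using Suc.prems(2)[OF f(1)] by blast
    have pN: "p N \<noteq> 0"
    proof
      assume "p N = 0"
      then have "f = (\<lambda>z. \<Sum>i<N. p i * g i z)" by (simp add: p)
      then show False using f by (auto simp: B_def)
    qed
    define e' where "e' = (\<lambda>j. if j < d then e j else u)"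
    have span: "\<exists>c. q = (\<lambda>z. \<Sum>j<Suc d. c j * e' j z)" if qA: "q \<in> A" for q
    proof -
      obtain b where b: "q = (\<lambda>z. \<Sum>i<Suc N. b i * g i z)" using Suc.prems(2)[OF qA] by blast
      define l where "l = b N / p N"
      have "(\<lambda>z. q z + (-l) * f z) = (\<lambda>z. \<Sum>i<N. (b i - l * p i) * g i z)"
        unfolding b p using pN
        by (simp add: l_def sum.distrib sum_distrib_left sum_subtractf sum_negf algebra_simps)
      then have "\<exists>c. (\<lambda>z. q z + (-l) * f z) = (\<lambda>z. \<Sum>i<N. c i * g i z)"
        by (rule exI[of _ "\<lambda>i. b i - l * p i"])
      then have "(\<lambda>z. q z + (-l) * f z) \<in> B"
        unfolding B_def using add_mem[OF qA f(1), of "-l"] by simp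
      from B.add_mem[OF this sB, of l] obtain c
        where c: "(\<lambda>z. q z + (-l) * f z + l * s z) = (\<lambda>z. \<Sum>j<d. c j * e j z)"
        using e unfolding orthonormal_basis_def by blast
      have "q z = (\<Sum>j<d. c j * e j z) + l * complex_of_real (sqrt a) * u z" for z
        using fun_cong[OF c, of z] fu[of z] by (simp add: algebra_simps)
      then have "q = (\<lambda>z. \<Sum>j<Suc d. (c(d := l * complex_of_real (sqrt a))) j * e' j z)"
        by (simp add: e'_def fun_eq_iff)
      then show ?thesis by (rule exI[of _ "c(d := l * complex_of_real (sqrt a))"])
    qed
    have "orthonormal_basis M A (Suc d) e'"
      using eA uA e ue eu uu span by (auto simp: orthonormal_basis_def e'_def less_Suc_eq)
    then show ?thesis by blast
  qed
qed

lemma Pol2_span: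
  assumes "f \<in> Pol2 n"
  shows "\<exists>c. f = (\<lambda>z. \<Sum>i<2 * n. c i * (cnj z ^ (i div n) * z ^ (i mod n)))"
proof -
  obtain c where c: "f = (\<lambda>z. \<Sum>r\<in>{0..1::nat}. \<Sum>j<n. c r j * (cnj z ^ r * z ^ j))"
    using assms by (auto simp: Pol2_def)
  have "(\<Sum>r\<in>{0..1::nat}. \<Sum>j<n. c r j * (cnj z ^ r * z ^ j))
        = (\<Sum>i<2 * n. c (i div n) (i mod n) * (cnj z ^ (i div n) * z ^ (i mod n)))" for z
  proof -
    have "(\<Sum>i<n * 2. c (i div n) (i mod n) * (cnj z ^ (i div n) * z ^ (i mod n)))
        = (\<Sum>r<2. \<Sum>j<n. c ((j + r * n) div n) ((j + r * n) mod n) *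
             (cnj z ^ ((j + r * n) div n) * z ^ ((j + r * n) mod n)))"
      using sum.nat_group[of "\<lambda>i. c (i div n) (i mod n) * (cnj z ^ (i div n) * z ^ (i mod n))" n 2]
      by (simp add: numeral_2_eq_2 atLeast0LessThan mult.commute lessThan_Suc
          sum.shift_bounds_nat_ivl[of _ 0 n n, simplified, unfolded atLeast0LessThan] mult_2)
    also have "\<dots> = (\<Sum>r<2. \<Sum>j<n. c r j * (cnj z ^ r * z ^ j))"
      by (intro sum.cong refl) auto
    also have "{..<2} = {0..1::nat}" by auto
    finally show ?thesis by (simp add: mult.commute)
  qed
  then show ?thesis unfolding c by (intro exI[of _ "\<lambda>i. c (i div n) (i mod n)"]) simp
qed

lemma Pol2_continuous: "f \<in> Pol2 n \<Longrightarrow> continuous_on UNIV f"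
  by (auto simp: Pol2_def intro!: continuous_intros)

lemma A2_function_inner_space:
  assumes Q: "continuous_on UNIV Q"
  shows "function_inner_space (weighted_dA m Q) (A2 m Q n)"
proof
  let ?M = "weighted_dA m Q"
  have [measurable]: "Q \<in> borel_measurable borel"
    using Q by (rule borel_measurable_continuous_onI)
  have sets_M [measurable_cong]: "sets ?M = sets borel"
    by (simp add: weighted_dA_def dA_def)
  have cont: "continuous_on UNIV f" if "f \<in> A2 m Q n" for f
    using that Pol2_continuous by (auto simp: A2_def)
  have borel: "f \<in> borel_measurable ?M" if "f \<in> A2 m Q n" for f
    using that by (auto simp: A2_def L2_def)
  have sq: "integrable ?M (\<lambda>z. (cmod (f z))\<^sup>2)" if "f \<in> A2 m Q n" for f
    using that by (auto simp: A2_def L2_def)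
  have "(\<lambda>_. 0) = (\<lambda>z. \<Sum>r\<in>{0..1::nat}. \<Sum>j<n. 0 * (cnj z ^ r * z ^ j))" by simp
  then have "(\<lambda>_. 0) \<in> Pol2 n"
    unfolding Pol2_def by (intro CollectI exI[of _ "\<lambda>_ _. 0"])
  then show "(\<lambda>_. 0) \<in> A2 m Q n" by (simp add: A2_def L2_def)
  fix f g assume f: "f \<in> A2 m Q n"
  { assume g: "g \<in> A2 m Q n"
    note [measurable] = borel[OF f] borel[OF g]
    show "integrable ?M (\<lambda>z. f z * cnj (g z))"
    proof (rule Bochner_Integration.integrable_bound)
      show "integrable ?M (\<lambda>z. (cmod (f z))\<^sup>2 + (cmod (g z))\<^sup>2)"
        by (intro Bochner_Integration.integrable_add sq f g)
      have "cnj \<in> borel_measurable borel"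
        by (intro borel_measurable_continuous_onI continuous_intros)
      then show "(\<lambda>z. f z * cnj (g z)) \<in> borel_measurable ?M" by measurable
      have "x * y \<le> x\<^sup>2 + y\<^sup>2" if "x \<ge> 0" "y \<ge> 0" for x y :: real
        using sum_squares_bound[of x y] mult_nonneg_nonneg[OF that] by linarith
      then show "AE z in ?M. norm (f z * cnj (g z)) \<le> norm ((cmod (f z))\<^sup>2 + (cmod (g z))\<^sup>2)"
        by (intro AE_I2) (simp add: norm_mult)
    qed
    fix c
    obtain a b where "f = (\<lambda>z. \<Sum>r\<in>{0..1::nat}. \<Sum>j<n. a r j * (cnj z ^ r * z ^ j))"
      "g = (\<lambda>z. \<Sum>r\<in>{0..1::nat}. \<Sum>j<n. b r j * (cnj z ^ r * z ^ j))"
      using f g by (auto simp: A2_def Pol2_def)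
    then have "(\<lambda>z. f z + c * g z) =
        (\<lambda>z. \<Sum>r\<in>{0..1::nat}. \<Sum>j<n. (a r j + c * b r j) * (cnj z ^ r * z ^ j))"
      by (simp only: sum_distrib_left sum.distrib[symmetric] distrib_right mult.assoc)
    then have pol: "(\<lambda>z. f z + c * g z) \<in> Pol2 n"
      unfolding Pol2_def by (intro CollectI exI)
    have "integrable ?M (\<lambda>z. (cmod (f z + c * g z))\<^sup>2)"
    proof (rule Bochner_Integration.integrable_bound)
      show "integrable ?M (\<lambda>z. 2 * (cmod (f z))\<^sup>2 + 2 * (cmod c)\<^sup>2 * (cmod (g z))\<^sup>2)"
        using sq[OF f] sq[OF g] by simp
      show "(\<lambda>z. (cmod (f z + c * g z))\<^sup>2) \<in> borel_measurable ?M" by measurable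
      have "(cmod (f z + c * g z))\<^sup>2 \<le> 2 * (cmod (f z))\<^sup>2 + 2 * (cmod c)\<^sup>2 * (cmod (g z))\<^sup>2" for z
      proof -
        have "(cmod (f z + c * g z))\<^sup>2 \<le> (cmod (f z) + cmod (c * g z))\<^sup>2"
          by (intro power_mono norm_triangle_ineq) auto
        also have "\<dots> \<le> 2 * (cmod (f z))\<^sup>2 + 2 * (cmod (c * g z))\<^sup>2"
          using sum_squares_bound[of "cmod (f z)" "cmod (c * g z)"] by (simp add: power2_sum)
        finally show ?thesis by (simp add: norm_mult power_mult_distrib)
      qed
      then show "AE z in ?M. norm ((cmod (f z + c * g z))\<^sup>2)
          \<le> norm (2 * (cmod (f z))\<^sup>2 + 2 * (cmod c)\<^sup>2 * (cmod (g z))\<^sup>2)"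
        by (intro AE_I2) simp
    qed
    then show "(\<lambda>z. f z + c * g z) \<in> A2 m Q n"
      using pol by (simp add: A2_def L2_def) }
  assume 0: "L2_inner ?M f f = 0"
  have "L2_inner ?M f f = of_real (\<integral>z. (cmod (f z))\<^sup>2 \<partial>?M)"
    unfolding L2_inner_def complex_norm_square[symmetric] by (rule integral_complex_of_real)
  then have "(\<integral>z. (cmod (f z))\<^sup>2 \<partial>?M) = 0" using 0 by (metis of_real_eq_0_iff)
  then have "AE z in ?M. f z = 0"
    by (subst (asm) integral_nonneg_eq_0_iff_AE[OF sq[OF f]]) simp_all
  then have "AE z in lborel. f z = 0"
    unfolding weighted_dA_def dA_def by (simp add: AE_density)
  then have "AE z in lebesgue. z \<in> f -` {0}"
    by (simp add: AE_completion)
  moreover have "closed (f -` {0})"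
    by (rule closed_vimage[OF _ cont[OF f]]) simp
  ultimately show "f = (\<lambda>_. 0)"
    using mem_closed_if_AE_lebesgue by (intro ext) blast
qed

theorem orthonormal_basis_exists:
  assumes "continuous_on UNIV Q"
  shows "\<exists>d e. orthonormal_basis (weighted_dA m Q) (A2 m Q n) d e"
  by (rule orthonormal_basis_exists_aux[OF A2_function_inner_space[OF assms] Pol2_span[of _ n]])
     (simp add: A2_def)

theorem K2_eq:
  assumes "continuous_on UNIV Q" and "orthonormal_basis (weighted_dA m Q) (A2 m Q n) d e"
  shows "K2 m Q n z w = (\<Sum>j<d. e j z * cnj (e j w))"
proof -
  interpret function_inner_space "weighted_dA m Q" "A2 m Q n"
    by (rule A2_function_inner_space) fact
  show ?thesis
    unfolding K2_def using assms(2) by (intro the_equality) (auto intro: kernel_unique)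
qed



subsection \<open>Subharmonic functions and the equilibrium weight\<close>

text \<open>The integral of an extended real function, as the difference of the integrals of its
  positive and negative parts. For a function that is bounded above the first of these is
  finite, and the mean is a well-defined element of \<open>[-\<infinity>, \<infinity>)\<close>.\<close>

definition circle_mean :: "(complex \<Rightarrow> ereal) \<Rightarrow> complex \<Rightarrow> real \<Rightarrow> ereal" where
  "circle_mean u z r =
     (enn2ereal (\<integral>\<^sup>+t\<in>{0..2*pi}. e2ennreal (u (z + of_real r * cis t)) \<partial>lborel) -
      enn2ereal (\<integral>\<^sup>+t\<in>{0..2*pi}. e2ennreal (- u (z + of_real r * cis t)) \<partial>lborel)) / ereal (2 * pi)"

text \<open>Upper semicontinuous functions into \<open>[-\<infinity>, \<infinity>)\<close> with the sub-mean value property on \<open>\<complex>\<close>.\<close>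

definition subharmonic :: "(complex \<Rightarrow> ereal) \<Rightarrow> bool" where
  "subharmonic u \<longleftrightarrow>
     (\<forall>z. u z \<noteq> \<infinity>) \<and>
     (\<forall>a. open {z. u z < a}) \<and>
     (\<forall>z. \<forall>r>0. u z \<le> circle_mean u z r)"

text \<open>Largest for the pointwise order. For \<open>Q\<close> continuous and
  \<open>\<ge> (1 + \<epsilon>) * ln ((cmod z)\<^sup>2)\<close> near infinity, \<open>ln (1 + (cmod z)\<^sup>2) - c\<close> is admissible for
  large \<open>c\<close>, so that the values of the largest function are finite.\<close>

definition equilibrium_weight :: "(complex \<Rightarrow> real) \<Rightarrow> complex \<Rightarrow> ereal" where
  "equilibrium_weight Q =
     (GREATEST u. subharmonic u \<and> (\<forall>z. u z \<le> ereal (Q z)) \<and>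
        (\<exists>B::real. \<forall>\<^sub>F z in at_infinity. \<bar>u z - ereal (ln ((cmod z)\<^sup>2))\<bar> \<le> ereal B))"

end

theory Submission
  imports Defs "HOL-Complex_Analysis.Complex_Analysis"
    "HOL-Computational_Algebra.Fundamental_Theorem_Algebra"
begin

text \<open>
  Write an element of \<open>A2 m Q n\<close> as \<open>f = p + cnj z * q\<close> with polynomials \<open>p\<close>, \<open>q\<close> of degree \<open>< n\<close>.
  Although \<open>log |f|\<close> need not be subharmonic, \<open>log |p|\<close> and \<open>log |z * q|\<close> are, and both \<open>p\<close> and \<open>z * q\<close>
  have degree at most \<open>n \<le> m\<close>. It is therefore enough to bound these two polynomials separately,
  which is where one power of \<open>m\<close> is lost: \<open>q\<close> is the \<open>cnj z\<close>-derivative of \<open>f\<close>, and on the natural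
  scale \<open>1 / sqrt m\<close> a derivative costs a factor \<open>sqrt m\<close>.

  Local step (\<open>bianalytic_weighted_pointwise\<close>). On the disc of radius \<open>1 / sqrt m\<close> about \<open>a\<close>, Taylor's
  formula shows that \<open>exp (- m * Q)\<close> is, up to a constant factor, the modulus squared of a zero-free
  entire function times \<open>exp (- m * Q a)\<close>. Multiplication by that function preserves bianalyticity,
  so that the unweighted estimate \<open>bianalytic_unit_disc\<close>, an averaging over circles, gives
  \<open>|f a|^2 + |q a|^2 / m \<le> C * m * exp (m * Q a) * ||f||^2\<close>, uniformly for \<open>a\<close> in a fixed disc.
  Hence \<open>p\<close> and \<open>z * q\<close> satisfy \<open>|g|^2 \<le> C * m^2 * exp (m * Q) * ||f||^2\<close> on this disc.

  Global step (\<open>poly_le_exp_equilibrium_weight\<close>). Let \<open>|g|^2 \<le> A * exp (m * Q)\<close> on a large disc, where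
  \<open>g\<close> is a polynomial of degree at most \<open>m\<close>. The function \<open>log (|g|^2 / A) / m\<close>, cut off from below by
  a constant, is continuous and subharmonic. By the maximum principle outside the unit circle
  (\<open>subharmonic_le_outside\<close>) it is at most \<open>log |z|^2 + O(1)\<close> with a bound depending only on \<open>Q\<close>, hence
  at most \<open>Q\<close> also outside the large disc. After taking the maximum with \<open>max (log |z|^2) 0 - c\<close> it
  competes in the definition of the equilibrium weight, so that \<open>|g|^2 \<le> A * exp (m * Qhat)\<close> on all of
  the plane, where \<open>Qhat\<close> is the equilibrium weight. That a greatest competitor exists
  (\<open>equilibrium_weight_greatest\<close>) is Perron's
  argument: the upper semicontinuous regularization of the pointwise supremum is again a competitor.

  Finally, \<open>K(z, z)\<close> is the value at \<open>z\<close> and the squared norm of one and the same element of the space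
  (\<open>kernel_extremal_function\<close>), to which the two steps are applied.
\<close>

section \<open>Circle means of logarithms of polynomials\<close>

lemma holomorphic_unit_circle_mean:
  fixes f :: "complex \<Rightarrow> complex"
  assumes "f holomorphic_on S" "open S" "cball 0 1 \<subseteq> S"
  shows "((\<lambda>t. f (cis t)) has_integral 2 * pi * f 0) {0..2*pi}"
proof -
  have "f holomorphic_on ball 0 1" "continuous_on (cball 0 1) f"
    using assms holomorphic_on_subset holomorphic_on_imp_continuous_on ball_subset_cball by (meson order_trans)+
  then have "((\<lambda>u. f u / (u - 0)) has_contour_integral (2 * of_real pi * \<i> * f 0)) (circlepath 0 1)"
    by (intro Cauchy_integral_circlepath) auto
  then have "((\<lambda>t. f (cis t) / cis t * \<i> * cis t) has_integral (2 * of_real pi * \<i> * f 0)) {0..2*pi}"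
    unfolding circlepath_def by (subst (asm) has_contour_integral_part_circlepath_iff) auto
  then have "((\<lambda>t. (-\<i>) * (f (cis t) / cis t * \<i> * cis t)) has_integral (-\<i>) * (2 * of_real pi * \<i> * f 0)) {0..2*pi}"
    by (rule has_integral_mult_right)
  moreover have "(-\<i>) * (f (cis t) / cis t * \<i> * cis t) = f (cis t)" for t
    by (simp add: field_simps)
  moreover have "(-\<i>) * (2 * of_real pi * \<i> * f 0) = 2 * pi * f 0"
    by (simp add: algebra_simps)
  ultimately show ?thesis by (simp only:)
qed

text \<open>The real part of the principal logarithm of \<open>1 + \<zeta> * w\<close> is harmonic on a half plane that contains
  the closed unit disc, and it vanishes at \<open>0\<close>.\<close>

lemma log_one_plus_circle_mean:
  assumes "cmod \<zeta> < 1"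
  shows "((\<lambda>t. ln (cmod (1 + \<zeta> * cis t))) has_integral 0) {0..2*pi}"
proof -
  define S where "S = {w. Re (1 + \<zeta> * w) > 0}"
  have S: "open S" unfolding S_def by (intro open_Collect_less continuous_intros)
  have nz: "1 + \<zeta> * w \<notin> \<real>\<^sub>\<le>\<^sub>0" if "w \<in> S" for w
    using that by (auto simp: S_def complex_nonpos_Reals_iff)
  have sub: "cball 0 1 \<subseteq> S"
  proof
    fix w :: complex assume "w \<in> cball 0 1"
    then have "cmod (\<zeta> * w) < 1" using assms
      by (simp add: norm_mult) (metis mult_left_le norm_ge_zero order_le_less_trans)
    then show "w \<in> S" unfolding S_def using abs_Re_le_cmod[of "\<zeta> * w"] by auto
  qed
  have "(\<lambda>w. Ln (1 + \<zeta> * w)) holomorphic_on S"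
    using nz by (auto intro!: holomorphic_intros)
  from holomorphic_unit_circle_mean[OF this S sub]
  have "((\<lambda>t. Ln (1 + \<zeta> * cis t)) has_integral 0) {0..2*pi}" by simp
  from has_integral_linear[OF this bounded_linear_Re]
  have "((\<lambda>t. Re (Ln (1 + \<zeta> * cis t))) has_integral 0) {0..2*pi}" by (simp add: o_def)
  moreover have "Re (Ln (1 + \<zeta> * cis t)) = ln (cmod (1 + \<zeta> * cis t))" for t
  proof -
    have "cis t \<in> S" using sub by auto
    then have "1 + \<zeta> * cis t \<noteq> 0" using nz by fastforce
    then show ?thesis by (rule Re_Ln)
  qed
  ultimately show ?thesis by simp
qed

lemma has_integral_const_circle: "((\<lambda>t. c :: real) has_integral 2 * pi * c) {0..2*pi}"
  using has_integral_const_real[of c 0 "2*pi"] by simp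

lemma log_circle_mean_outside:
  assumes "0 \<le> r" "r < cmod a"
  shows "((\<lambda>t. ln (cmod (a + of_real r * cis t))) has_integral 2 * pi * ln (cmod a)) {0..2*pi}"
proof -
  have a: "a \<noteq> 0" using assms by auto
  have lt: "cmod (of_real r / a) < 1" using assms a by (simp add: norm_divide)
  have "ln (cmod (a + of_real r * cis t)) = ln (cmod a) + ln (cmod (1 + of_real r / a * cis t))" for t
  proof -
    have "cmod (of_real r / a * cis t) < 1" using lt by (simp add: norm_mult norm_divide)
    then have "1 + of_real r / a * cis t \<noteq> 0"
      by (metis add_eq_0_iff norm_minus_cancel norm_one order_less_irrefl)
    moreover have "a + of_real r * cis t = a * (1 + of_real r / a * cis t)" using a by (simp add: field_simps)
    ultimately show ?thesis using a by (simp add: norm_mult ln_mult)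
  qed
  with has_integral_add[OF has_integral_const_circle[of "ln (cmod a)"] log_one_plus_circle_mean[OF lt]]
  show ?thesis by simp
qed

text \<open>On the circle, \<open>a + r * cis t\<close> has the same modulus as \<open>r + cnj a * cis t\<close>: the zero is reflected
  to the outside of the circle.\<close>

lemma log_circle_mean_inside:
  assumes "cmod a < r"
  shows "((\<lambda>t. ln (cmod (a + of_real r * cis t))) has_integral 2 * pi * ln r) {0..2*pi}"
proof -
  have r: "r > 0" using assms norm_ge_zero by (rule le_less_trans[rotated])
  have lt: "cmod (cnj a / of_real r) < 1" using assms r by (simp add: norm_divide)
  have "ln (cmod (a + of_real r * cis t)) = ln r + ln (cmod (1 + cnj a / of_real r * cis t))" for t
  proof -
    have "cmod (cnj a / of_real r * cis t) < 1" using lt by (simp add: norm_mult norm_divide)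
    then have nz: "1 + cnj a / of_real r * cis t \<noteq> 0"
      by (metis add_eq_0_iff norm_minus_cancel norm_one order_less_irrefl)
    have "a + of_real r * cis t = of_real r * cis t * cnj (1 + cnj a / of_real r * cis t)"
      using r by (simp add: field_simps cis_cnj cis_mult)
    then have "cmod (a + of_real r * cis t) = r * cmod (1 + cnj a / of_real r * cis t)"
      using r by (simp only: norm_mult complex_mod_cnj norm_cis) (simp add: norm_mult)
    then show ?thesis using r nz by (simp add: ln_mult)
  qed
  with has_integral_add[OF has_integral_const_circle[of "ln r"] log_one_plus_circle_mean[OF lt]]
  show ?thesis by simp
qed

text \<open>The elementary part of Jensen's formula. The logarithm is additive over the linear factors, and for
  each factor the circle mean of \<open>ln |w - a|\<close> is \<open>ln (max |z - a| r)\<close>.\<close>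

lemma log_poly_circle_mean:
  fixes p :: "complex poly"
  assumes "poly p z \<noteq> 0" "r > 0" "\<And>t. poly p (z + of_real r * cis t) \<noteq> 0"
  shows "\<exists>I. ((\<lambda>t. ln (cmod (poly p (z + of_real r * cis t)))) has_integral I) {0..2*pi} \<and>
             2 * pi * ln (cmod (poly p z)) \<le> I"
  using assms
proof (induction "degree p" arbitrary: p)
  case 0
  then obtain c where "p = [:c:]" by (metis degree_0_id)
  then show ?case using has_integral_const_circle[of "ln (cmod c)"] by auto
next
  case (Suc d)
  then have "\<not> constant (poly p)" by (simp add: constant_degree)
  then obtain a where "poly p a = 0" using fundamental_theorem_of_algebra by blast
  then obtain q where p: "p = [:-a, 1:] * q" by (auto simp: poly_eq_0_iff_dvd dvd_def)
  have "q \<noteq> 0" using Suc.prems(1) p by auto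
  then have "degree p = Suc (degree q)" unfolding p by (subst degree_mult_eq) auto
  then have "d = degree q" using Suc.hyps(2) by simp
  then obtain I where I: "((\<lambda>t. ln (cmod (poly q (z + of_real r * cis t)))) has_integral I) {0..2*pi}"
      "2 * pi * ln (cmod (poly q z)) \<le> I"
    using Suc.hyps(1)[of q] Suc.prems by (auto simp: p)
  have ne: "z - a \<noteq> 0" using Suc.prems(1) by (auto simp: p)
  have "cmod (z - a) \<noteq> r"
  proof
    assume *: "cmod (z - a) = r"
    define t where "t = Arg (a - z)"
    have "a - z = of_real r * cis t"
      using rcis_cmod_Arg[of "a - z"] * by (simp add: t_def rcis_def norm_minus_commute)
    then have "z + of_real r * cis t = a" by (simp add: algebra_simps)
    then show False using Suc.prems(3)[of t] by (simp add: p)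
  qed
  then have "\<exists>J. ((\<lambda>t. ln (cmod (z - a + of_real r * cis t))) has_integral J) {0..2*pi} \<and>
             2 * pi * ln (cmod (z - a)) \<le> J"
  proof (cases "r < cmod (z - a)")
    case True
    then show ?thesis using log_circle_mean_outside[of r "z - a"] Suc.prems(2) by auto
  next
    case False
    then have "cmod (z - a) < r" using \<open>cmod (z - a) \<noteq> r\<close> by simp
    moreover have "ln (cmod (z - a)) \<le> ln r" using calculation ne Suc.prems(2) by (subst ln_le_cancel_iff) auto
    ultimately show ?thesis using log_circle_mean_inside[of "z - a" r] by auto
  qed
  then obtain J where J: "((\<lambda>t. ln (cmod (z - a + of_real r * cis t))) has_integral J) {0..2*pi}"
             "2 * pi * ln (cmod (z - a)) \<le> J" by blast
  have split: "ln (cmod (poly p w)) = ln (cmod (w - a)) + ln (cmod (poly q w))" if "poly p w \<noteq> 0" for w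
  proof -
    have "poly p w = (w - a) * poly q w" by (simp add: p algebra_simps)
    then show ?thesis using that by (simp add: norm_mult ln_mult)
  qed
  have "((\<lambda>t. ln (cmod (poly p (z + of_real r * cis t)))) has_integral J + I) {0..2*pi}"
    using has_integral_add[OF J(1) I(1)] Suc.prems(3) by (subst split) (auto simp: algebra_simps)
  moreover have "2 * pi * ln (cmod (poly p z)) \<le> J + I"
    using J(2) I(2) Suc.prems(1) by (subst split) (auto simp: algebra_simps)
  ultimately show ?case by blast
qed

lemma circle_avoiding_zeros_eventually:
  fixes p :: "complex poly"
  assumes "p \<noteq> 0"
  shows "\<forall>\<^sub>F r in at_right r0. \<forall>t. poly p (z + of_real r * cis t) \<noteq> 0"
proof -
  have "finite ((\<lambda>a. cmod (a - z)) ` {a. poly p a = 0})"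
    using assms by (intro finite_imageI poly_roots_finite)
  then have "\<forall>\<^sub>F r in at_right r0. \<forall>s \<in> (\<lambda>a. cmod (a - z)) ` {a. poly p a = 0}. \<bar>r\<bar> \<noteq> s"
  proof (intro eventually_ball_finite ballI)
    fix s
    have "\<forall>\<^sub>F r in at_right r0. r \<noteq> s \<and> r \<noteq> -s"
      by (intro eventually_conj eventually_neq_at_within)
    then show "\<forall>\<^sub>F r in at_right r0. \<bar>r\<bar> \<noteq> s" by eventually_elim (auto simp: abs_if split: if_splits)
  qed
  then show ?thesis
  proof eventually_elim
    case (elim r)
    show ?case
    proof (intro allI notI)
      fix t assume "poly p (z + of_real r * cis t) = 0"
      then have "cmod (z + of_real r * cis t - z) \<noteq> \<bar>r\<bar>" using elim by fastforce
      then show False by (simp add: norm_mult)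
    qed
  qed
qed

text \<open>The truncation by \<open>\<eta>\<close> keeps the function continuous and finite. Circles through a zero of \<open>p\<close>, where
  \<open>log_poly_circle_mean\<close> does not apply, are limits of circles with slightly larger radii that avoid
  the finitely many zeros, and the circle mean of a continuous function depends continuously on the radius.\<close>

lemma log_max_poly_submean:
  fixes p :: "complex poly"
  assumes "\<kappa> \<ge> 0" "\<eta> > 0" "r > 0"
  defines "u \<equiv> \<lambda>z. ln (max (\<kappa> * (cmod (poly p z))\<^sup>2) \<eta>)"
  shows "2 * pi * u z \<le> integral {0..2*pi} (\<lambda>t. u (z + of_real r * cis t))"
proof -
  have pos: "max (\<kappa> * (cmod (poly p w))\<^sup>2) \<eta> > 0" for w using assms(2) by (simp add: less_max_iff_disj)
  have cont: "continuous_on UNIV u" unfolding u_def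
    using pos by (intro continuous_intros ballI) (auto simp: less_imp_neq[symmetric])
  have contc: "continuous_on A (\<lambda>t. u (z + of_real s * cis t))" for A s
    by (intro continuous_on_compose2[OF cont] continuous_intros) auto
  have int: "(\<lambda>t. u (z + of_real s * cis t)) integrable_on {0..2*pi}" for s
    by (intro integrable_continuous_real contc)
  show ?thesis
  proof (cases "\<kappa> * (cmod (poly p z))\<^sup>2 \<le> \<eta>")
    case True
    then have "u z = ln \<eta>" by (simp add: u_def max_def)
    moreover have "ln \<eta> \<le> u w" for w unfolding u_def using assms(2) by (intro ln_mono) auto
    ultimately show ?thesis
      using has_integral_le[OF has_integral_const_circle[of "ln \<eta>"] integrable_integral[OF int]] by auto
  next
    case False
    then have nz: "poly p z \<noteq> 0" and k: "\<kappa> > 0" using assms by (auto simp: less_le)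
    have uz: "u z = ln \<kappa> + 2 * ln (cmod (poly p z))"
      using False k nz by (simp add: u_def max_def ln_mult ln_realpow)
    have ge: "2 * pi * u z \<le> integral {0..2*pi} (\<lambda>t. u (z + of_real s * cis t))"
      if s: "s > 0" "\<forall>t. poly p (z + of_real s * cis t) \<noteq> 0" for s
    proof -
      obtain I where I: "((\<lambda>t. ln (cmod (poly p (z + of_real s * cis t)))) has_integral I) {0..2*pi}"
             "2 * pi * ln (cmod (poly p z)) \<le> I"
        using log_poly_circle_mean[of p z s] nz s by auto
      have "((\<lambda>t. ln \<kappa> + 2 * ln (cmod (poly p (z + of_real s * cis t)))) has_integral (2 * pi * ln \<kappa> + 2 * I)) {0..2*pi}"
        by (intro has_integral_add has_integral_const_circle has_integral_mult_right I(1))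
      moreover have "ln \<kappa> + 2 * ln (cmod (poly p w)) \<le> u w" if "poly p w \<noteq> 0" for w
      proof -
        have "ln \<kappa> + 2 * ln (cmod (poly p w)) = ln (\<kappa> * (cmod (poly p w))\<^sup>2)"
          using k that by (simp add: ln_mult ln_realpow)
        also have "\<dots> \<le> u w" unfolding u_def using k that by (intro ln_mono) auto
        finally show ?thesis .
      qed
      ultimately have "2 * pi * ln \<kappa> + 2 * I \<le> integral {0..2*pi} (\<lambda>t. u (z + of_real s * cis t))"
        using s(2) by (intro has_integral_le[OF _ integrable_integral[OF int]]) auto
      then show ?thesis using I(2) by (simp add: uz algebra_simps)
    qed
    have "continuous_on UNIV (\<lambda>s. integral (cbox 0 (2*pi)) (\<lambda>t. u (z + of_real s * cis t)))"
      by (intro integral_continuous_on_param)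
         (auto simp: case_prod_unfold intro!: continuous_on_compose2[OF cont] continuous_intros)
    then have "((\<lambda>s. integral {0..2*pi} (\<lambda>t. u (z + of_real s * cis t))) \<longlongrightarrow>
        integral {0..2*pi} (\<lambda>t. u (z + of_real r * cis t))) (at_right r)"
      by (auto simp: continuous_on_def intro: tendsto_within_subset)
    moreover have "\<forall>\<^sub>F s in at_right r. 2 * pi * u z \<le> integral {0..2*pi} (\<lambda>t. u (z + of_real s * cis t))"
    proof -
      have "p \<noteq> 0" using nz by auto
      from circle_avoiding_zeros_eventually[OF this, of z r] eventually_at_right_less[of r]
      show ?thesis
      proof eventually_elim
        case (elim s)
        then show ?case using ge[of s] assms(3) by auto
      qed
    qed
    ultimately show ?thesis by (rule tendsto_lowerbound) simp
  qed
qed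

section \<open>The mean value inequality\<close>

lemma e2ennreal_diff_add:
  assumes "g \<le> ereal C" "C \<ge> 0"
  shows "e2ennreal (ereal C - g) + e2ennreal g = ennreal C + e2ennreal (- g)"
proof (cases g)
  case (real x)
  then show ?thesis
  proof (cases "x \<ge> 0")
    case True
    then show ?thesis using assms real
      by (simp add: e2ennreal_ereal ennreal_neg flip: ennreal_plus)
  next
    case False
    then show ?thesis using assms real
      by (simp add: e2ennreal_ereal ennreal_neg flip: ennreal_plus)
  qed
qed (use assms in \<open>auto simp: e2ennreal_neg\<close>)

text \<open>For a function bounded above by \<open>C\<close>, the difference of the integrals of the positive and negative
  parts is replaced by the single nonnegative integral of \<open>C - u\<close>, to which Fatou's lemma and monotonicity apply
  without any case distinction about infinite values.\<close>

lemma circle_mean_ge_iff: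
  assumes meas: "(\<lambda>t. u (z + of_real r * cis t)) \<in> borel_measurable borel"
    and bd: "\<And>t. u (z + of_real r * cis t) \<le> ereal C" and "C \<ge> 0" "a \<le> C"
  shows "ereal a \<le> circle_mean u z r \<longleftrightarrow>
    (\<integral>\<^sup>+t\<in>{0..2*pi}. e2ennreal (ereal C - u (z + of_real r * cis t)) \<partial>lborel) \<le> ennreal (2 * pi * (C - a))"
proof -
  let ?g = "\<lambda>t. u (z + of_real r * cis t)"
  note [measurable] = meas
  define P where "P = (\<integral>\<^sup>+t\<in>{0..2*pi}. e2ennreal (?g t) \<partial>lborel)"
  define N where "N = (\<integral>\<^sup>+t\<in>{0..2*pi}. e2ennreal (- ?g t) \<partial>lborel)"
  define I where "I = (\<integral>\<^sup>+t\<in>{0..2*pi}. e2ennreal (ereal C - ?g t) \<partial>lborel)"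
  have const: "(\<integral>\<^sup>+t\<in>{0..2*pi}. ennreal C \<partial>lborel) = ennreal (2 * pi * C)"
    using \<open>C \<ge> 0\<close> by (simp add: nn_integral_cmult_indicator ennreal_mult' mult.commute)
  have "I + P = (\<integral>\<^sup>+t. e2ennreal (ereal C - ?g t) * indicator {0..2*pi} t
                     + e2ennreal (?g t) * indicator {0..2*pi} t \<partial>lborel)"
    unfolding I_def P_def by (rule nn_integral_add[symmetric]; measurable)
  also have "\<dots> = (\<integral>\<^sup>+t. ennreal C * indicator {0..2*pi} t
                     + e2ennreal (- ?g t) * indicator {0..2*pi} t \<partial>lborel)"
    by (intro nn_integral_cong) (simp add: distrib_right[symmetric] e2ennreal_diff_add[OF bd \<open>C \<ge> 0\<close>])
  also have "\<dots> = ennreal (2 * pi * C) + N"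
    unfolding N_def const[symmetric] by (intro nn_integral_add) measurable
  finally have eq: "I + P = ennreal (2 * pi * C) + N" .
  have "e2ennreal (?g t) \<le> ennreal C" for t
    using e2ennreal_mono[OF bd[of t]] by (simp add: e2ennreal_ereal)
  then have "P \<le> (\<integral>\<^sup>+t\<in>{0..2*pi}. ennreal C \<partial>lborel)"
    unfolding P_def by (intro nn_integral_mono mult_right_mono) auto
  then have "P < \<infinity>" unfolding const by (simp add: order_le_less_trans)
  then obtain p where p: "p \<ge> 0" "P = ennreal p" by (cases P) auto
  have cm: "circle_mean u z r = (enn2ereal P - enn2ereal N) / ereal (2 * pi)"
    unfolding circle_mean_def P_def N_def ..
  have "ereal a \<le> circle_mean u z r \<longleftrightarrow> I \<le> ennreal (2 * pi * (C - a))"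
  proof (cases N)
    case top
    then have "I = top" using eq p by simp
    then show ?thesis using top p by (auto simp: cm top_unique)
  next
    case (real n)
    then have "I \<noteq> top" using arg_cong[OF eq, of "\<lambda>x. x = top"] by auto
    then obtain i where i: "i \<ge> 0" "I = ennreal i" by (cases I) auto
    have "i + p = 2 * pi * C + n"
      using eq i p real \<open>C \<ge> 0\<close> by (simp flip: ennreal_plus)
    then have "a \<le> (p - n) / (2 * pi) \<longleftrightarrow> i \<le> 2 * pi * (C - a)"
      unfolding le_divide_eq using pi_gt_zero by (simp add: algebra_simps) linarith
    moreover have "0 \<le> 2 * pi * (C - a)" using \<open>a \<le> C\<close> by simp
    moreover have "circle_mean u z r = ereal ((p - n) / (2 * pi))"
      using p real by (simp add: cm enn2ereal_ennreal)
    ultimately show ?thesis using i by (simp add: ennreal_le_iff)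
  qed
  then show ?thesis by (simp add: I_def)
qed

lemma borel_measurable_usc:
  fixes u :: "complex \<Rightarrow> ereal"
  assumes "\<forall>a. open {z. u z < a}"
  shows "u \<in> borel_measurable borel"
  using assms by (intro borel_measurableI_less) auto

lemma measurable_circle:
  fixes u :: "complex \<Rightarrow> 'b::topological_space"
  assumes "u \<in> borel_measurable borel"
  shows "(\<lambda>t. u (z + of_real r * cis t)) \<in> borel_measurable borel"
proof -
  have "(\<lambda>t. z + of_real r * cis t) \<in> borel_measurable borel"
    by (intro borel_measurable_continuous_onI continuous_intros)
  from measurable_compose[OF this assms] show ?thesis .
qed

lemma subharmonic_circle_integral_le:
  assumes "subharmonic u" "r > 0" "\<And>t. u (z + of_real r * cis t) \<le> ereal C" "C \<ge> 0" "a \<le> C" "ereal a \<le> u z"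
  shows "(\<integral>\<^sup>+t\<in>{0..2*pi}. e2ennreal (ereal C - u (z + of_real r * cis t)) \<partial>lborel) \<le> ennreal (2 * pi * (C - a))"
proof -
  have "ereal a \<le> circle_mean u z r" using assms by (auto simp: subharmonic_def intro: order_trans)
  then show ?thesis
    using assms by (subst (asm) circle_mean_ge_iff[where C=C])
      (auto simp: subharmonic_def intro!: measurable_circle borel_measurable_usc)
qed

lemma nn_integral_Icc_continuous:
  fixes g :: "real \<Rightarrow> real"
  assumes "continuous_on {a..b} g" "\<And>t. t \<in> {a..b} \<Longrightarrow> 0 \<le> g t"
  shows "(\<integral>\<^sup>+t\<in>{a..b}. ennreal (g t) \<partial>lborel) = ennreal (integral {a..b} g)"
proof -
  let ?h = "\<lambda>t. if t \<in> {a..b} then g t else 0"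
  have "?h \<in> borel_measurable borel"
  proof -
    have "?h = (\<lambda>t. indicator {a..b} t *\<^sub>R g t)" by (auto simp: indicator_def)
    then show ?thesis using borel_measurable_continuous_on_indicator[OF _ assms(1)] by simp
  qed
  moreover have "(?h has_integral integral {a..b} g) UNIV"
    using integrable_continuous_real[OF assms(1)] unfolding has_integral_restrict_UNIV by (rule integrable_integral)
  ultimately have "(\<integral>\<^sup>+t. ennreal (?h t) \<partial>lborel) = ennreal (integral {a..b} g)"
    using assms(2) by (intro nn_integral_has_integral_lborel) auto
  moreover have "ennreal (?h t) = ennreal (g t) * indicator {a..b} t" for t by (simp add: indicator_def)
  ultimately show ?thesis by simp
qed

lemma continuous_circle_bound:
  fixes u :: "complex \<Rightarrow> real"
  assumes "continuous_on UNIV u"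
  obtains C where "C \<ge> 0" "\<And>w. w \<in> cball z r \<Longrightarrow> u w \<le> C"
proof -
  have "bounded (u ` cball z r)"
    by (intro compact_imp_bounded compact_continuous_image continuous_on_subset[OF assms]) auto
  then obtain B where "\<And>w. w \<in> cball z r \<Longrightarrow> \<bar>u w\<bar> \<le> B" unfolding bounded_iff by (auto simp del: mem_cball)
  then have "\<And>w. w \<in> cball z r \<Longrightarrow> u w \<le> max B 0" by fastforce
  then show ?thesis using that[of "max B 0"] by auto
qed

lemma subharmonic_continuousI:
  fixes u :: "complex \<Rightarrow> real"
  assumes cont: "continuous_on UNIV u"
    and sub: "\<And>z r. r > 0 \<Longrightarrow> 2 * pi * u z \<le> integral {0..2*pi} (\<lambda>t. u (z + of_real r * cis t))"
  shows "subharmonic (\<lambda>z. ereal (u z))"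
  unfolding subharmonic_def
proof (intro conjI allI impI)
  show "open {z. ereal (u z) < a}" for a
    using cont by (intro open_Collect_less continuous_intros) auto
  fix z and r :: real assume r: "r > 0"
  obtain C where C: "C \<ge> 0" "\<And>w. w \<in> cball z r \<Longrightarrow> u w \<le> C" using continuous_circle_bound[OF cont] by blast
  have le: "u (z + of_real r * cis t) \<le> C" for t using r by (intro C(2)) (simp add: dist_norm norm_mult)
  have ct: "continuous_on {0..2*pi} (\<lambda>t. u (z + of_real r * cis t))"
    by (intro continuous_on_compose2[OF cont] continuous_intros) auto
  have "(\<integral>\<^sup>+t\<in>{0..2*pi}. ennreal (C - u (z + of_real r * cis t)) \<partial>lborel)
      = ennreal (integral {0..2*pi} (\<lambda>t. C - u (z + of_real r * cis t)))"
    using le by (intro nn_integral_Icc_continuous continuous_intros ct) auto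
  also have "integral {0..2*pi} (\<lambda>t. C - u (z + of_real r * cis t))
      = 2 * pi * C - integral {0..2*pi} (\<lambda>t. u (z + of_real r * cis t))"
    by (subst Henstock_Kurzweil_Integration.integral_diff)
       (auto intro: integrable_continuous_real ct)
  also have "ennreal \<dots> \<le> ennreal (2 * pi * (C - u z))"
    using sub[OF r, of z] by (intro ennreal_leI) (simp add: algebra_simps)
  finally show "ereal (u z) \<le> circle_mean (\<lambda>z. ereal (u z)) z r"
    using le C r cont by (subst circle_mean_ge_iff[where C=C])
      (auto simp: e2ennreal_ereal intro!: borel_measurable_continuous_onI measurable_circle continuous_intros)
qed simp

text \<open>Continuous subharmonic functions, with the mean value inequality in terms of the gauge integral:
  closure under maxima and positive affine maps is then immediate.\<close>

definition submean :: "(complex \<Rightarrow> real) \<Rightarrow> bool" where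
  "submean u \<longleftrightarrow> continuous_on UNIV u \<and>
     (\<forall>z. \<forall>r>0. 2 * pi * u z \<le> integral {0..2*pi} (\<lambda>t. u (z + of_real r * cis t)))"

lemma submean_integrable:
  "submean u \<Longrightarrow> (\<lambda>t. u (z + of_real r * cis t)) integrable_on {0..2*pi}"
  unfolding submean_def
  by (intro integrable_continuous_real) (auto intro!: continuous_on_compose2[of UNIV u] continuous_intros)

lemma submean_affine:
  assumes "submean u" "c \<ge> 0"
  shows "submean (\<lambda>z. c * u z + d)"
  unfolding submean_def
proof (intro conjI allI impI)
  show "continuous_on UNIV (\<lambda>z. c * u z + d)" using assms by (auto simp: submean_def intro!: continuous_intros)
  fix z and r :: real assume "r > 0"
  then have "c * (2 * pi * u z) \<le> c * integral {0..2*pi} (\<lambda>t. u (z + of_real r * cis t))"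
    using assms by (intro mult_left_mono) (auto simp: submean_def)
  moreover have "integral {0..2*pi} (\<lambda>t. c * u (z + of_real r * cis t) + d)
     = c * integral {0..2*pi} (\<lambda>t. u (z + of_real r * cis t)) + 2 * pi * d"
    using has_integral_add[OF has_integral_mult_right[OF integrable_integral[OF submean_integrable[OF assms(1)]]]
        has_integral_const_circle] by (rule integral_unique)
  ultimately show "2 * pi * (c * u z + d) \<le> integral {0..2*pi} (\<lambda>t. c * u (z + of_real r * cis t) + d)"
    by (simp add: algebra_simps)
qed

lemma submean_max:
  assumes u: "submean u" and v: "submean v"
  shows "submean (\<lambda>z. max (u z) (v z))"
proof -
  have c: "continuous_on UNIV (\<lambda>z. max (u z) (v z))" using assms by (auto simp: submean_def intro!: continuous_intros)
  have int: "(\<lambda>t. max (u (z + of_real r * cis t)) (v (z + of_real r * cis t))) integrable_on {0..2*pi}" for z r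
    by (intro integrable_continuous_real continuous_on_compose2[OF c] continuous_intros) auto
  have "2 * pi * u z \<le> integral {0..2*pi} (\<lambda>t. max (u (z + of_real r * cis t)) (v (z + of_real r * cis t)))"
    if "r > 0" for z r
  proof -
    have "2 * pi * u z \<le> integral {0..2*pi} (\<lambda>t. u (z + of_real r * cis t))"
      using that u by (auto simp: submean_def)
    also have "\<dots> \<le> integral {0..2*pi} (\<lambda>t. max (u (z + of_real r * cis t)) (v (z + of_real r * cis t)))"
      by (intro integral_le submean_integrable u int) auto
    finally show ?thesis .
  qed
  moreover have "2 * pi * v z \<le> integral {0..2*pi} (\<lambda>t. max (u (z + of_real r * cis t)) (v (z + of_real r * cis t)))"
    if "r > 0" for z r
  proof -
    have "2 * pi * v z \<le> integral {0..2*pi} (\<lambda>t. v (z + of_real r * cis t))"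
      using that v by (auto simp: submean_def)
    also have "\<dots> \<le> integral {0..2*pi} (\<lambda>t. max (u (z + of_real r * cis t)) (v (z + of_real r * cis t)))"
      by (intro integral_le submean_integrable v int) auto
    finally show ?thesis .
  qed
  ultimately show ?thesis unfolding submean_def using c by (auto simp: max_def)
qed

lemma submean_log_max_poly:
  assumes "\<kappa> \<ge> 0" "\<eta> > 0"
  shows "submean (\<lambda>z. ln (max (\<kappa> * (cmod (poly p z))\<^sup>2) \<eta>))"
proof -
  have "max (\<kappa> * (cmod (poly p w))\<^sup>2) \<eta> > 0" for w using assms(2) by (simp add: less_max_iff_disj)
  then have "continuous_on UNIV (\<lambda>z. ln (max (\<kappa> * (cmod (poly p z))\<^sup>2) \<eta>))"
    by (intro continuous_intros ballI) (auto simp: less_imp_neq[symmetric])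
  then show ?thesis using log_max_poly_submean[OF assms] by (simp add: submean_def)
qed

section \<open>A maximum principle near infinity\<close>

lemma usc_attains_max:
  fixes f :: "complex \<Rightarrow> ereal"
  assumes "compact K" "K \<noteq> {}" and usc: "\<And>a. open {z. f z < a}"
  shows "\<exists>x\<in>K. \<forall>y\<in>K. f y \<le> f x"
proof (rule ccontr)
  assume "\<not> ?thesis"
  then have "K \<subseteq> (\<Union>y\<in>K. {z. f z < f y})" by (force simp: not_le)
  then obtain Y where Y: "Y \<subseteq> K" "finite Y" "K \<subseteq> (\<Union>y\<in>Y. {z. f z < f y})"
    using compactE_image[OF assms(1), of K "\<lambda>y. {z. f z < f y}"] usc by blast
  then have "f ` Y \<noteq> {}" "finite (f ` Y)" using assms(2) by auto
  then obtain y0 where y0: "y0 \<in> Y" "f y0 = Max (f ` Y)" by (metis Max_in imageE)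
  then obtain y where "y \<in> Y" "f y0 < f y" using Y by blast
  then show False using y0 Max_ge[OF \<open>finite (f ` Y)\<close>, of "f y"] by auto
qed

lemma open_usc_diff_less:
  fixes u :: "complex \<Rightarrow> ereal"
  assumes "\<forall>a. open {z. u z < a}" "continuous_on UNIV h"
  shows "open {z. u z - ereal (h z) < a}"
proof -
  have "{z. u z - ereal (h z) < a} = (\<Union>b. {z. u z < ereal b} \<inter> {z. ereal (b - h z) < a})"
  proof (intro equalityI subsetI)
    fix z assume "z \<in> {z. u z - ereal (h z) < a}"
    then have "u z < a + ereal (h z)" by (simp add: ereal_minus_less)
    then obtain b where "u z < ereal b" "ereal b < a + ereal (h z)" using ereal_dense2 by blast
    then show "z \<in> (\<Union>b. {z. u z < ereal b} \<inter> {z. ereal (b - h z) < a})"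
      by (cases a) auto
  next
    fix z assume "z \<in> (\<Union>b. {z. u z < ereal b} \<inter> {z. ereal (b - h z) < a})"
    then obtain b where b: "u z < ereal b" "ereal (b - h z) < a" by auto
    then show "z \<in> {z. u z - ereal (h z) < a}" by (cases "u z"; cases a) auto
  qed
  moreover have "open ({z. u z < ereal b} \<inter> {z. ereal (b - h z) < a})" for b
  proof (rule open_Int)
    show "open {z. u z < ereal b}" using assms(1) by blast
    show "open {z. ereal (b - h z) < a}" by (intro open_Collect_less continuous_intros assms(2))
  qed
  ultimately show ?thesis by auto
qed

text \<open>The maximum principle on \<open>|z| \<ge> R\<close>. The extra term \<open>\<eta> * ln |z|\<close> makes \<open>u - h\<close> negative near infinity,
  so that a positive supremum would be attained at some \<open>z0\<close>. The circle about \<open>z0\<close> that touches \<open>|z| = R\<close>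
  does not enclose the origin, so \<open>h\<close> has the mean value property on it. Hence \<open>u - h\<close> equals its maximum almost
  everywhere on this circle, while it is strictly smaller near the point of contact.\<close>

lemma subharmonic_le_outside_aux:
  fixes u :: "complex \<Rightarrow> ereal"
  assumes sub: "subharmonic u" and R: "R > 0" and M: "\<And>z. cmod z = R \<Longrightarrow> u z \<le> ereal M"
    and growth: "\<forall>\<^sub>F z in at_infinity. u z \<le> ereal (ln ((cmod z)\<^sup>2) + B)"
    and "\<eta> > 0" "R \<le> cmod z1"
  shows "u z1 \<le> ereal (M + (2 + \<eta>) * ln (cmod z1 / R))"
proof (rule ccontr)
  \<comment> \<open>The maximum with \<open>1\<close> extends the harmonic comparison function continuously across the origin.\<close>
  define h where "h = (\<lambda>z. M + (2 + \<eta>) * ln (max (cmod z / R) 1))"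
  define w where "w = (\<lambda>z. u z - ereal (h z))"
  have usc: "\<forall>a. open {z. u z < a}" using sub by (simp add: subharmonic_def)
  have um: "u \<in> borel_measurable borel" by (rule borel_measurable_usc[OF usc])
  have conth: "continuous_on UNIV h" unfolding h_def using R
    by (intro continuous_intros ballI) auto
  have h: "h z = M + (2 + \<eta>) * ln (cmod z / R)" if "R \<le> cmod z" for z
    using that R by (simp add: h_def max_def)
  assume "\<not> ?thesis"
  then have z1: "w z1 > 0" using h[OF assms(6)] by (cases "u z1") (auto simp: w_def)
  obtain T0 where T0: "\<And>z. T0 \<le> cmod z \<Longrightarrow> u z \<le> ereal (ln ((cmod z)\<^sup>2) + B)"
    using growth by (auto simp: eventually_at_infinity)
  define T where "T = max (max T0 (max R 1)) (exp ((B - M + (2 + \<eta>) * ln R) / \<eta>))"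
  have far: "w z \<le> 0" if "cmod z \<ge> T" for z
  proof -
    have *: "cmod z \<ge> T0" "cmod z \<ge> R" "cmod z \<ge> 1" "cmod z \<ge> exp ((B - M + (2 + \<eta>) * ln R) / \<eta>)"
      using that by (auto simp: T_def)
    have "(B - M + (2 + \<eta>) * ln R) / \<eta> \<le> ln (cmod z)"
      using *(3,4) by (subst ln_ge_iff) auto
    then have "B - M + (2 + \<eta>) * ln R \<le> \<eta> * ln (cmod z)" using \<open>\<eta> > 0\<close> by (simp add: field_simps)
    moreover have "ln ((cmod z)\<^sup>2) = 2 * ln (cmod z)" using *(3) by (subst ln_realpow) auto
    moreover have "ln (cmod z / R) = ln (cmod z) - ln R" using *(3) R by (subst ln_div) auto
    moreover have "h z = M + (2 + \<eta>) * (ln (cmod z) - ln R)" using calculation(3) by (simp add: h[OF *(2)])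
    ultimately have "ln ((cmod z)\<^sup>2) + B \<le> h z" by (simp add: algebra_simps)
    then have "u z \<le> ereal (h z)" using T0[OF *(1)] by (meson ereal_less_eq(3) order_trans)
    then show ?thesis unfolding w_def by (cases "u z") auto
  qed
  have near: "w z \<le> 0" if "cmod z = R" for z
    using M[OF that] that R h[of z] by (cases "u z") (auto simp: w_def)
  have uscw: "open {z. w z < a}" for a unfolding w_def by (rule open_usc_diff_less[OF usc conth])
  define A where "A = cball 0 T \<inter> - ball (0::complex) R"
  have "compact A" unfolding A_def by (intro compact_Int_closed) auto
  moreover have z1A: "z1 \<in> A"
  proof -
    have "cmod z1 < T" using far[of z1] z1 by (meson leD leI)
    then show ?thesis using assms(6) by (auto simp: A_def)
  qed
  ultimately obtain z0 where z0: "z0 \<in> A" "\<And>y. y \<in> A \<Longrightarrow> w y \<le> w z0"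
    using usc_attains_max[of A w, OF _ _ uscw] by blast
  have pos: "w z0 > 0" using z0(2)[OF z1A] z1 by simp
  have max: "w y \<le> w z0" if "cmod y \<ge> R" for y
  proof (cases "cmod y \<le> T")
    case True
    then show ?thesis using that by (intro z0) (auto simp: A_def)
  next
    case False
    then show ?thesis using far[of y] pos by auto
  qed
  have "u z0 \<noteq> \<infinity>" using sub by (simp add: subharmonic_def)
  then obtain a where a: "u z0 = ereal a" using pos by (cases "u z0") (auto simp: w_def)
  define S where "S = a - h z0"
  have S: "w z0 = ereal S" "S > 0" using a pos by (auto simp: w_def S_def)
  have z0R: "cmod z0 > R" using near[of z0] pos z0(1) by (force simp: A_def)
  define r where "r = cmod z0 - R"
  have r: "r > 0" "r < cmod z0" using z0R R by (auto simp: r_def)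
  have out: "cmod (z0 + of_real r * cis t) \<ge> R" for t
  proof -
    have "cmod z0 \<le> cmod (z0 + of_real r * cis t) + cmod (of_real r * cis t)"
      using norm_triangle_ineq4[of "z0 + of_real r * cis t" "of_real r * cis t"] by simp
    moreover have "cmod (of_real r * cis t) = r" using r by (simp add: norm_mult)
    ultimately show ?thesis unfolding r_def by linarith
  qed
  let ?p = "\<lambda>t. z0 + of_real r * cis t"
  have ule: "u (?p t) \<le> ereal (h (?p t) + S)" for t
    using max[OF out[of t]] S by (cases "u (?p t)") (auto simp: w_def)
  obtain C0 where C0: "C0 \<ge> 0" "\<And>y. y \<in> cball z0 r \<Longrightarrow> h y \<le> C0" using continuous_circle_bound[OF conth] by blast
  define C where "C = C0 + S"
  have hC: "h (?p t) + S \<le> C" for t using r C0(2)[of "?p t"] by (simp add: dist_norm norm_mult C_def)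
  have "h z0 \<le> C0" using r by (intro C0) auto
  then have aC: "a \<le> C" by (simp add: C_def S_def)
  have ct: "continuous_on X (\<lambda>t. h (?p t))" for X
    by (intro continuous_on_compose2[OF conth] continuous_intros) auto
  define k c where "k = M - (2 + \<eta>) * ln R" and "c = 2 + \<eta>"
  have hl: "h y = k + c * ln (cmod y)" if "cmod y \<ge> R" for y
  proof -
    have "cmod y > 0" using that R by linarith
    then have "ln (cmod y / R) = ln (cmod y) - ln R" using R by (simp add: ln_div)
    then show ?thesis unfolding h[OF that] k_def c_def by (simp only:) (simp add: algebra_simps)
  qed
  have "((\<lambda>t. k + c * ln (cmod (?p t))) has_integral 2 * pi * k + c * (2 * pi * ln (cmod z0))) {0..2*pi}"
    using r by (intro has_integral_add has_integral_const_circle has_integral_mult_right log_circle_mean_outside) auto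
  moreover have "(\<lambda>t. h (?p t)) = (\<lambda>t. k + c * ln (cmod (?p t)))" using hl[OF out] by simp
  moreover have "2 * pi * h z0 = 2 * pi * k + c * (2 * pi * ln (cmod z0))"
    using hl[of z0] z0R by (simp add: algebra_simps)
  ultimately have hmean: "((\<lambda>t. h (?p t)) has_integral 2 * pi * h z0) {0..2*pi}" by (simp only:)
  define J where "J = (\<integral>\<^sup>+t\<in>{0..2*pi}. ennreal (C - S - h (?p t)) \<partial>lborel)"
  define D where "D = (\<integral>\<^sup>+t\<in>{0..2*pi}. e2ennreal (ereal (h (?p t) + S) - u (?p t)) \<partial>lborel)"
  have "J = ennreal (integral {0..2*pi} (\<lambda>t. C - S - h (?p t)))"
    unfolding J_def using hC by (intro nn_integral_Icc_continuous continuous_intros ct) (simp add: algebra_simps)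
  also have "integral {0..2*pi} (\<lambda>t. C - S - h (?p t)) = 2 * pi * (C - S) - 2 * pi * h z0"
    using has_integral_diff[OF has_integral_const_circle hmean] by (rule integral_unique)
  also have "\<dots> = 2 * pi * (C - a)" by (simp add: S_def algebra_simps)
  finally have J: "J = ennreal (2 * pi * (C - a))" .
  have mh: "(\<lambda>t. h (?p t)) \<in> borel_measurable borel" by (intro borel_measurable_continuous_onI ct)
  have mu: "(\<lambda>t. u (?p t)) \<in> borel_measurable borel" by (rule measurable_circle[OF um])
  note [measurable] = mh mu
  have "J + D = (\<integral>\<^sup>+t. ennreal (C - S - h (?p t)) * indicator {0..2*pi} t +
       e2ennreal (ereal (h (?p t) + S) - u (?p t)) * indicator {0..2*pi} t \<partial>lborel)"
    unfolding J_def D_def by (rule nn_integral_add[symmetric]; measurable)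
  also have "\<dots> = (\<integral>\<^sup>+t\<in>{0..2*pi}. e2ennreal (ereal C - u (?p t)) \<partial>lborel)"
  proof (intro nn_integral_cong)
    fix t
    have "ennreal (C - S - h (?p t)) + e2ennreal (ereal (h (?p t) + S) - u (?p t)) = e2ennreal (ereal C - u (?p t))"
      using hC[of t] ule[of t] by (cases "u (?p t)") (auto simp: e2ennreal_ereal simp flip: ennreal_plus)
    then show "ennreal (C - S - h (?p t)) * indicator {0..2*pi} t +
       e2ennreal (ereal (h (?p t) + S) - u (?p t)) * indicator {0..2*pi} t
       = e2ennreal (ereal C - u (?p t)) * indicator {0..2*pi} t"
      by (simp add: distrib_right[symmetric])
  qed
  also have "\<dots> \<le> ennreal (2 * pi * (C - a))"
  proof (rule subharmonic_circle_integral_le[OF sub])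
    show "u (?p t) \<le> ereal C" for t using ule[of t] hC[of t] by (meson ereal_less_eq(3) order_trans)
  qed (use S(2) C0(1) aC a r in \<open>auto simp: C_def\<close>)
  finally have "J + D \<le> J + 0" by (simp add: J)
  then have "D = 0" unfolding J using ennreal_add_left_cancel_le[of "2 * pi * (C - a)" D 0] by auto
  then have "AE t in lborel. e2ennreal (ereal (h (?p t) + S) - u (?p t)) * indicator {0..2*pi} t = 0"
    unfolding D_def by (subst (asm) nn_integral_0_iff_AE; measurable)
  then have ae: "AE t in lborel. t \<in> {0..2*pi} \<longrightarrow> \<not> (w (?p t) < ereal S)"
  proof eventually_elim
    case (elim t)
    then show ?case by (cases "u (?p t)") (auto simp: w_def e2ennreal_ereal ennreal_eq_0_iff indicator_def)
  qed
  define U where "U = {t. w (?p t) < ereal S}"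
  have "open U"
  proof -
    have "U = ?p -` {z. w z < ereal S}" by (auto simp: U_def)
    moreover have "open (?p -` {z. w z < ereal S})"
      by (intro open_vimage uscw continuous_intros)
    ultimately show ?thesis by simp
  qed
  \<comment> \<open>The parameter of the point of contact with \<open>|z| = R\<close>.\<close>
  define t0 where "t0 = Arg2pi (- z0)"
  have t0: "t0 \<in> {0..2*pi}" unfolding t0_def using Arg2pi[of "- z0"] by auto
  have "- z0 = of_real (cmod z0) * cis t0"
    using Arg2pi[of "- z0"] by (simp add: t0_def cis_conv_exp is_Arg_def)
  then have z0eq: "z0 = - of_real (cmod z0) * cis t0" by (metis add.inverse_inverse mult_minus_left)
  have "?p t0 = - of_real R * cis t0" by (subst (1) z0eq) (simp add: r_def algebra_simps)
  then have "cmod (?p t0) = R" using R by (simp add: norm_mult)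
  then have "w (?p t0) \<le> 0" by (rule near)
  then have "t0 \<in> U" using S by (auto simp: U_def zero_ereal_def order_le_less_trans)
  \<comment> \<open>The point of contact may be the endpoint of the parameter interval; openness moves it to the interior.\<close>
  then have "U \<inter> closure {0<..<2*pi} \<noteq> {}" using t0 by (auto simp: closure_greaterThanLessThan)
  then have ne: "U \<inter> {0<..<2*pi} \<noteq> {}" using open_Int_closure_eq_empty[OF \<open>open U\<close>] by blast
  have op: "open (U \<inter> {0<..<2*pi})" using \<open>open U\<close> by auto
  have "AE t in lborel. t \<notin> U \<inter> {0<..<2*pi}"
    using ae by eventually_elim (auto simp: U_def)
  then have "U \<inter> {0<..<2*pi} \<in> null_sets lborel"
    using op by (subst AE_iff_null_sets) auto
  then have "negligible (U \<inter> {0<..<2*pi})"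
    by (simp add: negligible_iff_null_sets null_sets_completionI)
  then show False using open_not_negligible[OF op ne] by simp
qed

lemma subharmonic_le_outside:
  fixes u :: "complex \<Rightarrow> ereal"
  assumes sub: "subharmonic u" and R: "R > 0" and M: "\<And>z. cmod z = R \<Longrightarrow> u z \<le> ereal M"
    and growth: "\<forall>\<^sub>F z in at_infinity. u z \<le> ereal (ln ((cmod z)\<^sup>2) + B)"
    and z: "R \<le> cmod z"
  shows "u z \<le> ereal (M + 2 * ln (cmod z / R))"
proof -
  define L where "L = ln (cmod z / R)"
  have L: "L \<ge> 0" using z R by (simp add: L_def)
  have le: "u z \<le> ereal (M + (2 + \<eta>) * L)" if "\<eta> > 0" for \<eta>
    using subharmonic_le_outside_aux[OF sub R M growth that z] by (simp add: L_def)
  show ?thesis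
  proof (cases "u z")
    case (real x)
    have "x \<le> M + 2 * L + e" if "e > 0" for e
    proof -
      have "x \<le> M + (2 + e / (L + 1)) * L" using le[of "e / (L + 1)"] that L real by auto
      moreover have "e / (L + 1) * L \<le> e" using that L by (simp add: field_simps)
      ultimately show ?thesis by (simp add: algebra_simps)
    qed
    then have "x \<le> M + 2 * L" by (rule field_le_epsilon)
    then show ?thesis by (simp add: real L_def)
  qed (use le[of 1] in auto)
qed

section \<open>Existence of the greatest competitor\<close>

text \<open>The competitors among which \<open>equilibrium_weight Q\<close> is the greatest.\<close>

definition admissible :: "(complex \<Rightarrow> real) \<Rightarrow> (complex \<Rightarrow> ereal) \<Rightarrow> bool" where
  "admissible Q u \<longleftrightarrow> subharmonic u \<and> (\<forall>z. u z \<le> ereal (Q z)) \<and>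
     (\<exists>B::real. \<forall>\<^sub>F z in at_infinity. \<bar>u z - ereal (ln ((cmod z)\<^sup>2))\<bar> \<le> ereal B)"

definition envelope :: "(complex \<Rightarrow> real) \<Rightarrow> complex \<Rightarrow> ereal" where
  "envelope Q z = (SUP u\<in>{u. admissible Q u}. u z)"

definition usc_reg :: "(complex \<Rightarrow> ereal) \<Rightarrow> complex \<Rightarrow> ereal" where
  "usc_reg U z = (INF \<delta>\<in>{0::real<..}. SUP w\<in>ball z \<delta>. U w)"

lemma usc_reg_ge: "U z \<le> usc_reg U z"
  unfolding usc_reg_def by (intro INF_greatest SUP_upper) auto

lemma open_usc_reg_less: "open {z. usc_reg U z < a}"
  unfolding open_contains_ball
proof (intro ballI)
  fix z assume "z \<in> {z. usc_reg U z < a}"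
  then obtain \<delta> where \<delta>: "\<delta> > 0" "(SUP w\<in>ball z \<delta>. U w) < a"
    by (auto simp: usc_reg_def INF_less_iff)
  have "usc_reg U w < a" if w: "w \<in> ball z \<delta>" for w
  proof -
    define d where "d = \<delta> - dist z w"
    have d: "d > 0" using w by (simp add: d_def)
    have "ball w d \<subseteq> ball z \<delta>"
    proof
      fix x assume "x \<in> ball w d"
      then show "x \<in> ball z \<delta>" using dist_triangle[of z x w] by (simp add: d_def)
    qed
    then have "(SUP x\<in>ball w d. U x) \<le> (SUP x\<in>ball z \<delta>. U x)" by (intro SUP_subset_mono) auto
    moreover have "usc_reg U w \<le> (SUP x\<in>ball w d. U x)"
      unfolding usc_reg_def using d by (intro INF_lower) auto
    ultimately show ?thesis using \<delta>(2) by (meson order.trans order_le_less_trans)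
  qed
  then show "\<exists>e>0. ball z e \<subseteq> {z. usc_reg U z < a}" using \<delta>(1) by auto
qed

lemma usc_reg_le_continuous:
  assumes "open S" "continuous_on S g" "\<And>w. w \<in> S \<Longrightarrow> U w \<le> ereal (g w)" "z \<in> S"
  shows "usc_reg U z \<le> ereal (g z)"
proof (rule ereal_le_epsilon2)
  fix e :: real assume e: "e > 0"
  have "isCont g z" using assms by (simp add: continuous_on_eq_continuous_at)
  then obtain d1 where d1: "d1 > 0" "\<And>w. dist w z < d1 \<Longrightarrow> dist (g w) (g z) < e"
    using e unfolding continuous_at_eps_delta by blast
  obtain d2 where d2: "d2 > 0" "ball z d2 \<subseteq> S" using assms by (meson open_contains_ball)
  define d where "d = min d1 d2"
  have "usc_reg U z \<le> (SUP x\<in>ball z d. U x)"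
    unfolding usc_reg_def using d1 d2 by (intro INF_lower) (auto simp: d_def)
  also have "\<dots> \<le> ereal (g z + e)"
  proof (rule SUP_least)
    fix x assume "x \<in> ball z d"
    then have "x \<in> S" "dist x z < d1" using d2 by (auto simp: d_def dist_commute)
    then have "U x \<le> ereal (g x)" "g x \<le> g z + e"
      using assms(3) d1(2)[of x] by (auto simp: dist_real_def)
    then show "U x \<le> ereal (g z + e)" by (meson ereal_less_eq(3) order_trans)
  qed
  finally show "usc_reg U z \<le> ereal (g z) + ereal e" by simp
qed

lemma ennreal_diff_le_liminf_usc:
  fixes v :: "complex \<Rightarrow> real"
  assumes "\<And>a. open {z. v z < a}" "x \<longlonglongrightarrow> x0"
  shows "ennreal (C - v x0) \<le> liminf (\<lambda>k. ennreal (C - v (x k)))"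
  unfolding le_Liminf_iff
proof (intro allI impI)
  fix y assume y: "y < ennreal (C - v x0)"
  then obtain y' where y': "y' \<ge> 0" "y = ennreal y'" by (cases y) auto
  then have "y' < C - v x0" using y by (simp add: ennreal_less_iff)
  then have "x0 \<in> {z. v z < C - y'}" by simp
  then have "\<forall>\<^sub>F k in sequentially. x k \<in> {z. v z < C - y'}"
    by (rule topological_tendstoD[OF assms(2) assms(1)])
  then show "\<forall>\<^sub>F k in sequentially. y < ennreal (C - v (x k))"
    by eventually_elim (use y' in \<open>auto simp: ennreal_less_iff\<close>)
qed

text \<open>A bound independent of the competitor, although the constant in the growth condition is not:
  this makes the supremum of all competitors satisfy the growth condition too.\<close>

lemma admissible_upper:
  assumes "admissible Q u" "\<And>z. cmod z = 1 \<Longrightarrow> Q z \<le> M" "cmod z \<ge> 1"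
  shows "u z \<le> ereal (M + ln ((cmod z)\<^sup>2))"
proof -
  obtain B where B: "\<forall>\<^sub>F z in at_infinity. \<bar>u z - ereal (ln ((cmod z)\<^sup>2))\<bar> \<le> ereal B"
    using assms(1) by (auto simp: admissible_def)
  have "\<forall>\<^sub>F z in at_infinity. u z \<le> ereal (ln ((cmod z)\<^sup>2) + B)"
    using B
  proof eventually_elim
    case (elim z)
    then show ?case by (cases "u z") (auto simp: abs_le_iff)
  qed
  then have "u z \<le> ereal (M + 2 * ln (cmod z / 1))"
    using assms order_trans[of "u _" "ereal (Q _)" "ereal M"]
    by (intro subharmonic_le_outside) (auto simp: admissible_def)
  then show ?thesis by (simp add: ln_realpow)
qed

text \<open>For the mean value inequality at \<open>z\<close>, take points \<open>x k\<close> tending to \<open>z\<close> and competitors \<open>u k\<close> with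
  \<open>u k (x k)\<close> tending to the regularized value. The mean value inequalities of the \<open>u k\<close> on the circles about
  \<open>x k\<close> pass to the limit by Fatou's lemma, because the regularization \<open>v\<close> dominates every \<open>u k\<close> and is upper
  semicontinuous. A given real competitor \<open>b\<close> keeps \<open>v\<close> finite.\<close>

lemma admissible_usc_reg_envelope:
  assumes Q: "continuous_on UNIV Q" and b: "admissible Q (\<lambda>z. ereal (b z))"
  shows "admissible Q (usc_reg (envelope Q))"
proof -
  define V where "V = usc_reg (envelope Q)"
  have leU: "u z \<le> envelope Q z" if "admissible Q u" for u z
    using that unfolding envelope_def by (intro SUP_upper) auto
  have UQ: "envelope Q z \<le> ereal (Q z)" for z
    unfolding envelope_def by (intro SUP_least) (auto simp: admissible_def)
  have VQ: "V z \<le> ereal (Q z)" for z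
    unfolding V_def using UQ by (intro usc_reg_le_continuous[OF open_UNIV Q]) auto
  have bV: "ereal (b z) \<le> V z" for z
    unfolding V_def using leU[OF b] usc_reg_ge by (rule order_trans)
  define v where "v z = real_of_ereal (V z)" for z
  have Vv: "V z = ereal (v z)" for z
    using VQ[of z] bV[of z] by (cases "V z") (auto simp: v_def)
  have "open {z. ereal (v z) < ereal a}" for a
    unfolding Vv[symmetric] V_def by (rule open_usc_reg_less)
  then have usc: "open {z. v z < a}" for a by simp
  have vm [measurable]: "v \<in> borel_measurable borel"
    using usc by (intro borel_measurableI_less) auto
  have mean: "ereal (v z) \<le> circle_mean V z r" if r: "r > 0" for z r
  proof -
    obtain C where C: "C \<ge> 0" "\<And>w. w \<in> cball z (r + 1) \<Longrightarrow> Q w \<le> C" using continuous_circle_bound[OF Q] by blast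
    have vC: "v w \<le> C" if "w \<in> cball z (r + 1)" for w
      using VQ[of w] C(2)[OF that] by (simp add: Vv)
    define e where "e k = 1 / real (Suc k)" for k
    have e: "e k > 0" "e k \<le> 1" for k by (auto simp: e_def)
    have e0: "e \<longlonglongrightarrow> 0" unfolding e_def using LIMSEQ_Suc[OF lim_1_over_n] by simp
    have "\<exists>w u. w \<in> ball z (e k) \<and> admissible Q u \<and> ereal (v z - e k) < u w" for k
    proof -
      have "V z \<le> (SUP w\<in>ball z (e k). envelope Q w)"
        unfolding V_def usc_reg_def using e by (intro INF_lower) auto
      then have "ereal (v z - e k) < (SUP w\<in>ball z (e k). envelope Q w)"
        using e(1)[of k] by (simp add: Vv order_less_le_trans[of "ereal (v z - e k)" "ereal (v z)"])
      then show ?thesis by (fastforce simp: less_SUP_iff envelope_def)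
    qed
    then obtain x u where xu: "x k \<in> ball z (e k)" "admissible Q (u k)" "ereal (v z - e k) < u k (x k)" for k
      by metis
    have "dist (x k) z \<le> e k" for k using xu(1)[of k] by (simp add: dist_commute)
    then have x: "x \<longlonglongrightarrow> z"
      using e(1) by (intro metric_tendsto_imp_tendsto[OF e0]) (auto simp: dist_real_def less_imp_le)
    have near: "x k + of_real r * cis t \<in> cball z (r + 1)" for k t
    proof -
      have "dist z (x k + of_real r * cis t) \<le> dist z (x k) + dist (x k) (x k + of_real r * cis t)"
        by (rule dist_triangle)
      also have "dist (x k) (x k + of_real r * cis t) = r" using r by (simp add: dist_norm norm_mult)
      also have "dist z (x k) \<le> 1" using xu(1)[of k] e(2)[of k] by simp
      finally show ?thesis by (simp add: add.commute)
    qed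
    have step: "(\<integral>\<^sup>+t. ennreal (C - v (x k + of_real r * cis t)) * indicator {0..2*pi} t \<partial>lborel) \<le> ennreal (2 * pi * (C - (v z - e k)))" for k
    proof -
      have "ennreal (C - v (x k + of_real r * cis t)) \<le> e2ennreal (ereal C - u k (x k + of_real r * cis t))" for t
      proof -
        have "u k (x k + of_real r * cis t) \<le> V (x k + of_real r * cis t)"
          unfolding V_def using leU[OF xu(2)] usc_reg_ge by (rule order_trans)
        then have "ereal (C - v (x k + of_real r * cis t)) \<le> ereal C - u k (x k + of_real r * cis t)"
          unfolding Vv by (cases "u k (x k + of_real r * cis t)") auto
        then show ?thesis using e2ennreal_mono by (simp flip: e2ennreal_ereal)
      qed
      then have "(\<integral>\<^sup>+t. ennreal (C - v (x k + of_real r * cis t)) * indicator {0..2*pi} t \<partial>lborel)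
         \<le> (\<integral>\<^sup>+t. e2ennreal (ereal C - u k (x k + of_real r * cis t)) * indicator {0..2*pi} t \<partial>lborel)"
        by (intro nn_integral_mono mult_right_mono) auto
      also have "\<dots> \<le> ennreal (2 * pi * (C - (v z - e k)))"
      proof (rule subharmonic_circle_integral_le[OF _ r])
        show "subharmonic (u k)" using xu(2) by (auto simp: admissible_def)
        show "u k (x k + of_real r * cis t) \<le> ereal C" for t
          using xu(2)[of k] C(2)[OF near[of k t]] unfolding admissible_def by (meson ereal_less_eq(3) order_trans)
        show "C \<ge> 0" by fact
        show "v z - e k \<le> C" using vC[of z] e[of k] r by auto
        show "ereal (v z - e k) \<le> u k (x k)" using xu(3)[of k] by simp
      qed
      finally show ?thesis .
    qed
    have "(\<integral>\<^sup>+t\<in>{0..2*pi}. ennreal (C - v (z + of_real r * cis t)) \<partial>lborel)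
        \<le> (\<integral>\<^sup>+t. liminf (\<lambda>k. ennreal (C - v (x k + of_real r * cis t)) * indicator {0..2*pi} t) \<partial>lborel)"
    proof (intro nn_integral_mono)
      fix t
      have "(\<lambda>k. x k + of_real r * cis t) \<longlonglongrightarrow> z + of_real r * cis t" by (intro tendsto_intros x)
      from ennreal_diff_le_liminf_usc[OF usc this, of C]
      show "ennreal (C - v (z + of_real r * cis t)) * indicator {0..2*pi} t
        \<le> liminf (\<lambda>k. ennreal (C - v (x k + of_real r * cis t)) * indicator {0..2*pi} t)"
        by (cases "t \<in> {0..2*pi}") auto
    qed
    also have "\<dots> \<le> liminf (\<lambda>k. \<integral>\<^sup>+t. ennreal (C - v (x k + of_real r * cis t)) * indicator {0..2*pi} t \<partial>lborel)"
    proof (rule nn_integral_liminf)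
      fix k
      have [measurable]: "(\<lambda>t. v (x k + of_real r * cis t)) \<in> borel_measurable borel"
        by (rule measurable_circle[OF vm])
      show "(\<lambda>t. ennreal (C - v (x k + of_real r * cis t)) * indicator {0..2*pi} t) \<in> borel_measurable lborel"
        by measurable
    qed
    also have "\<dots> \<le> liminf (\<lambda>k. ennreal (2 * pi * (C - (v z - e k))))"
      by (intro Liminf_mono always_eventually allI step)
    also have "\<dots> = ennreal (2 * pi * (C - (v z - 0)))"
      by (intro lim_imp_Liminf tendsto_intros e0) auto
    finally have I: "(\<integral>\<^sup>+t\<in>{0..2*pi}. ennreal (C - v (z + of_real r * cis t)) \<partial>lborel) \<le> ennreal (2 * pi * (C - v z))" by simp
    show ?thesis
    proof (subst circle_mean_ge_iff[where C=C])
      show "(\<lambda>t. V (z + of_real r * cis t)) \<in> borel_measurable borel"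
        unfolding Vv using measurable_circle[OF vm] by simp
      show "V (z + of_real r * cis t) \<le> ereal C" for t
        using vC[of "z + of_real r * cis t"] r by (simp add: Vv dist_norm norm_mult)
      show "v z \<le> C" using vC[of z] r by simp
      show "(\<integral>\<^sup>+t\<in>{0..2*pi}. e2ennreal (ereal C - V (z + of_real r * cis t)) \<partial>lborel) \<le> ennreal (2 * pi * (C - v z))"
        using I by (simp add: Vv e2ennreal_ereal)
    qed fact
  qed
  have sub: "subharmonic V"
    unfolding subharmonic_def
  proof (intro conjI allI impI)
    show "open {z. V z < a}" for a unfolding V_def by (rule open_usc_reg_less)
    show "V z \<le> circle_mean V z r" if "r > 0" for z r using mean[OF that] by (simp add: Vv)
  qed (simp add: Vv)
  obtain B where B: "\<forall>\<^sub>F z in at_infinity. \<bar>ereal (b z) - ereal (ln ((cmod z)\<^sup>2))\<bar> \<le> ereal B"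
    using b by (auto simp: admissible_def)
  obtain M where M: "\<And>w. w \<in> cball 0 1 \<Longrightarrow> Q w \<le> M" using continuous_circle_bound[OF Q] by blast
  have up: "V z \<le> ereal (M + ln ((cmod z)\<^sup>2))" if "cmod z > 1" for z
    unfolding V_def
  proof (rule usc_reg_le_continuous[where S="{z. cmod z > 1}"])
    show "open {z::complex. cmod z > 1}" by (intro open_Collect_less continuous_intros)
    show "continuous_on {z. cmod z > 1} (\<lambda>z. M + ln ((cmod z)\<^sup>2))"
      by (intro continuous_intros ballI) auto
    fix w :: complex assume "w \<in> {z. cmod z > 1}"
    then show "envelope Q w \<le> ereal (M + ln ((cmod w)\<^sup>2))"
      unfolding envelope_def by (intro SUP_least admissible_upper) (auto intro!: M)
  qed (use that in auto)
  have "\<forall>\<^sub>F z in at_infinity. cmod z > (1::real)"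
    unfolding eventually_at_infinity by (intro exI[of _ 2]) auto
  with B have "\<forall>\<^sub>F z in at_infinity. \<bar>V z - ereal (ln ((cmod z)\<^sup>2))\<bar> \<le> ereal (max B M)"
  proof eventually_elim
    case (elim z)
    then have "\<bar>v z - ln ((cmod z)\<^sup>2)\<bar> \<le> max B M"
      using up[of z] bV[of z] by (auto simp: Vv abs_le_iff)
    then have "ereal \<bar>v z - ln ((cmod z)\<^sup>2)\<bar> \<le> ereal (max B M)" by (simp only: ereal_less_eq)
    then show ?case by (simp only: Vv ereal_minus abs_ereal.simps)
  qed
  then have "\<exists>B::real. \<forall>\<^sub>F z in at_infinity. \<bar>V z - ereal (ln ((cmod z)\<^sup>2))\<bar> \<le> ereal B" by blast
  then show ?thesis using sub VQ by (simp add: admissible_def V_def)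
qed

theorem equilibrium_weight_greatest:
  assumes Q: "continuous_on UNIV Q" and b: "admissible Q (\<lambda>z. ereal (b z))"
  shows "admissible Q (equilibrium_weight Q)"
    and "\<And>u. admissible Q u \<Longrightarrow> u \<le> equilibrium_weight Q"
proof -
  let ?V = "usc_reg (envelope Q)"
  have V: "admissible Q ?V" by (rule admissible_usc_reg_envelope[OF assms])
  have le: "u \<le> ?V" if "admissible Q u" for u
  proof (rule le_funI)
    fix z
    have "u z \<le> envelope Q z" using that unfolding envelope_def by (intro SUP_upper) auto
    then show "u z \<le> ?V z" using usc_reg_ge by (rule order_trans)
  qed
  have "equilibrium_weight Q = Greatest (admissible Q)"
    unfolding equilibrium_weight_def by (intro arg_cong[where f=Greatest] ext) (simp add: admissible_def)
  also have "\<dots> = ?V" by (rule Greatest_equality[where P="admissible Q", OF V]) (rule le)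
  finally show "admissible Q (equilibrium_weight Q)"
    and "\<And>u. admissible Q u \<Longrightarrow> u \<le> equilibrium_weight Q" using V le by auto
qed

corollary le_equilibrium_weight:
  fixes v :: "complex \<Rightarrow> real"
  assumes Q: "continuous_on UNIV Q" and v: "admissible Q (\<lambda>z. ereal (v z))"
  shows "v z \<le> real_of_ereal (equilibrium_weight Q z)"
proof -
  have "ereal (v z) \<le> equilibrium_weight Q z"
    using le_funD[OF equilibrium_weight_greatest(2)[OF Q v v], of z] .
  moreover have "equilibrium_weight Q z \<le> ereal (Q z)"
    using equilibrium_weight_greatest(1)[OF Q v] by (simp add: admissible_def)
  ultimately show ?thesis by (cases "equilibrium_weight Q z") auto
qed

section \<open>Rotation invariance of planar Lebesgue measure\<close>

lemma lborel_complex: "(lborel :: complex measure) = distr (lborel \<Otimes>\<^sub>M lborel) borel (\<lambda>(x, y). Complex x y)"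
proof (rule lborel_eqI)
  have cont: "continuous_on UNIV (\<lambda>p. Complex (fst p) (snd p))"
    unfolding Complex_eq by (intro continuous_intros)
  have meas [measurable]: "(\<lambda>(x, y). Complex x y) \<in> borel_measurable (lborel \<Otimes>\<^sub>M lborel)"
    unfolding lborel_prod using borel_measurable_continuous_onI[OF cont] by (simp add: case_prod_unfold)
  fix l u :: complex
  assume le: "\<And>b. b \<in> Basis \<Longrightarrow> l \<bullet> b \<le> u \<bullet> b"
  have "(\<lambda>(x, y). Complex x y) -` box l u = {Re l<..<Re u} \<times> {Im l<..<Im u}"
    by (auto simp: box_def Basis_complex_def)
  then have "emeasure (distr (lborel \<Otimes>\<^sub>M lborel) borel (\<lambda>(x, y). Complex x y)) (box l u)
     = emeasure (lborel \<Otimes>\<^sub>M lborel) ({Re l<..<Re u} \<times> {Im l<..<Im u})"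
    by (subst emeasure_distr) (auto simp: space_pair_measure)
  also have "\<dots> = ennreal (Re u - Re l) * ennreal (Im u - Im l)"
    using le[of 1] le[of \<i>] by (subst lborel.emeasure_pair_measure_Times) (auto simp: Basis_complex_def)
  also have "\<dots> = (\<Prod>b\<in>Basis. (u - l) \<bullet> b)"
    using le[of 1] le[of \<i>] by (simp add: Basis_complex_def ennreal_mult' complex_i_not_one[symmetric])
  finally show "emeasure (distr (lborel \<Otimes>\<^sub>M lborel) borel (\<lambda>(x, y). Complex x y)) (box l u)
      = (\<Prod>b\<in>Basis. (u - l) \<bullet> b)" .
qed simp

lemma measurable_Complex [measurable]: "(\<lambda>(x, y). Complex x y) \<in> borel_measurable (borel \<Otimes>\<^sub>M borel)"
proof -
  have "continuous_on UNIV (\<lambda>p. Complex (fst p) (snd p))"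
    unfolding Complex_eq by (intro continuous_intros)
  then show ?thesis
    unfolding borel_prod using borel_measurable_continuous_onI by (simp add: case_prod_unfold)
qed

lemma measurable_Complex' [measurable (raw)]:
  assumes "f \<in> borel_measurable M" "g \<in> borel_measurable M"
  shows "(\<lambda>x. Complex (f x) (g x)) \<in> borel_measurable M"
  using measurable_compose[OF measurable_Pair[OF assms] measurable_Complex] by simp

lemma nn_integral_complex:
  assumes [measurable]: "f \<in> borel_measurable borel"
  shows "(\<integral>\<^sup>+z. f z \<partial>lborel) = (\<integral>\<^sup>+y. \<integral>\<^sup>+x. f (Complex x y) \<partial>lborel \<partial>lborel)"
    and "(\<integral>\<^sup>+z. f z \<partial>lborel) = (\<integral>\<^sup>+x. \<integral>\<^sup>+y. f (Complex x y) \<partial>lborel \<partial>lborel)"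
proof -
  have "(\<integral>\<^sup>+z. f z \<partial>lborel) = (\<integral>\<^sup>+p. f (case p of (x, y) \<Rightarrow> Complex x y) \<partial>(lborel \<Otimes>\<^sub>M lborel))"
    by (subst lborel_complex, subst nn_integral_distr) auto
  also have "\<dots> = (\<integral>\<^sup>+x. \<integral>\<^sup>+y. f (Complex x y) \<partial>lborel \<partial>lborel)"
    by (subst lborel.nn_integral_fst[symmetric]) auto
  finally show *: "(\<integral>\<^sup>+z. f z \<partial>lborel) = (\<integral>\<^sup>+x. \<integral>\<^sup>+y. f (Complex x y) \<partial>lborel \<partial>lborel)" .
  show "(\<integral>\<^sup>+z. f z \<partial>lborel) = (\<integral>\<^sup>+y. \<integral>\<^sup>+x. f (Complex x y) \<partial>lborel \<partial>lborel)"
    unfolding * by (rule lborel_pair.Fubini') measurable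
qed

text \<open>Rotation by \<open>c = a + i * b\<close> is a composition of two shears with scalings by \<open>a\<close> and \<open>1 / a\<close>:
  the new first coordinate is \<open>X = a * x - b * y\<close>, and the second one is \<open>(b / a) * X + (1 / a) * y\<close>.
  Each is an affine substitution in one variable.\<close>

lemma nn_integral_rotate_aux:
  fixes c :: complex
  assumes f [measurable]: "f \<in> borel_measurable borel" and c: "cmod c = 1" "Re c \<noteq> 0"
  shows "(\<integral>\<^sup>+w. f (c * w) \<partial>lborel) = (\<integral>\<^sup>+w. f w \<partial>lborel)"
proof -
  define a b where "a = Re c" and "b = Im c"
  have a: "a \<noteq> 0" and ab: "a * a + b * b = 1"
    using c by (auto simp: a_def b_def cmod_def power2_eq_square)
  have cw: "c * Complex x y = Complex (a * x - b * y) (b * x + a * y)" for x y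
    by (simp add: complex_eq_iff a_def b_def)
  have m [measurable]: "(\<lambda>w. f (c * w)) \<in> borel_measurable borel"
    by (rule measurable_compose[OF _ f]) (intro borel_measurable_continuous_onI continuous_intros)
  define g where "g X y = f (Complex X (0 + (b / a) * X + (1 / a) * y))" for X y
  have fg: "f (c * Complex x y) = g (- b * y + a * x) y" for x y
  proof -
    have "b / a * (- b * y + a * x) + 1 / a * y = b * x + (1 - b * b) / a * y"
      using a by (simp add: field_simps)
    also have "(1 - b * b) / a = a" using ab a by (simp add: field_simps)
    finally show ?thesis unfolding g_def cw by (simp add: algebra_simps)
  qed
  have L: "(\<integral>\<^sup>+w. f (c * w) \<partial>lborel) = (\<integral>\<^sup>+y. \<integral>\<^sup>+x. g (- b * y + a * x) y \<partial>lborel \<partial>lborel)"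
    unfolding fg[symmetric] by (rule nn_integral_complex(1)) measurable
  have gm [measurable]: "(\<lambda>X. g X y) \<in> borel_measurable borel" for y
    unfolding g_def by measurable
  have gm2 [measurable]: "(\<lambda>(y, X). g X y) \<in> borel_measurable (borel \<Otimes>\<^sub>M borel)"
    unfolding g_def by measurable
  have "ennreal \<bar>a\<bar> * (\<integral>\<^sup>+w. f (c * w) \<partial>lborel) = (\<integral>\<^sup>+y. ennreal \<bar>a\<bar> * (\<integral>\<^sup>+x. g (- b * y + a * x) y \<partial>lborel) \<partial>lborel)"
    unfolding L by (rule nn_integral_cmult[symmetric]) (unfold g_def, measurable)
  also have "\<dots> = (\<integral>\<^sup>+y. \<integral>\<^sup>+X. g X y \<partial>lborel \<partial>lborel)"
    by (intro nn_integral_cong nn_integral_real_affine[symmetric] a gm)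
  also have "\<dots> = (\<integral>\<^sup>+X. \<integral>\<^sup>+y. g X y \<partial>lborel \<partial>lborel)"
    by (rule lborel_pair.Fubini') (unfold g_def, measurable)
  finally have 1: "ennreal \<bar>a\<bar> * (\<integral>\<^sup>+w. f (c * w) \<partial>lborel) = (\<integral>\<^sup>+X. \<integral>\<^sup>+y. g X y \<partial>lborel \<partial>lborel)" .
  have "(\<integral>\<^sup>+w. f w \<partial>lborel) = (\<integral>\<^sup>+X. \<integral>\<^sup>+Y. f (Complex X Y) \<partial>lborel \<partial>lborel)"
    by (rule nn_integral_complex(2)) measurable
  also have "\<dots> = (\<integral>\<^sup>+X. ennreal \<bar>1 / a\<bar> * (\<integral>\<^sup>+y. g X y \<partial>lborel) \<partial>lborel)"
    unfolding g_def using a by (intro nn_integral_cong nn_integral_real_affine) auto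
  also have "\<dots> = ennreal \<bar>1 / a\<bar> * (\<integral>\<^sup>+X. \<integral>\<^sup>+y. g X y \<partial>lborel \<partial>lborel)"
    by (rule nn_integral_cmult) (unfold g_def, measurable)
  also have "\<dots> = ennreal \<bar>1 / a\<bar> * (ennreal \<bar>a\<bar> * (\<integral>\<^sup>+w. f (c * w) \<partial>lborel))" by (simp only: 1)
  also have "\<dots> = (ennreal (\<bar>1 / a\<bar> * \<bar>a\<bar>)) * (\<integral>\<^sup>+w. f (c * w) \<partial>lborel)"
    by (subst ennreal_mult') (simp_all only: mult.assoc abs_ge_zero)
  also have "\<bar>1 / a\<bar> * \<bar>a\<bar> = 1" using a by simp
  finally show ?thesis by simp
qed

lemma nn_integral_rotate:
  fixes c :: complex
  assumes f [measurable]: "f \<in> borel_measurable borel" and c: "cmod c = 1"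
  shows "(\<integral>\<^sup>+w. f (c * w) \<partial>lborel) = (\<integral>\<^sup>+w. f w \<partial>lborel)"
proof (cases "Re c = 0")
  case False
  then show ?thesis using nn_integral_rotate_aux[OF f c] by simp
next
  case True
  define d where "d = cis (pi / 4)"
  have d: "cmod d = 1" "Re d = sqrt 2 / 2" "Im d = sqrt 2 / 2" by (auto simp: d_def cos_45 sin_45)
  have m: "(\<lambda>w. f (d * w)) \<in> borel_measurable borel"
    by (rule measurable_compose[OF _ f]) (intro borel_measurable_continuous_onI continuous_intros)
  have "Im c \<noteq> 0" using True c by (auto simp: cmod_def)
  then have "Re (cnj d * c) \<noteq> 0" using True by (simp add: d)
  moreover have "cmod (cnj d * c) = 1" using c d(1) by (simp add: norm_mult)
  ultimately have "(\<integral>\<^sup>+w. f (d * (cnj d * c * w)) \<partial>lborel) = (\<integral>\<^sup>+w. f (d * w) \<partial>lborel)"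
    by (intro nn_integral_rotate_aux[OF m])
  also have "\<dots> = (\<integral>\<^sup>+w. f w \<partial>lborel)" using d by (intro nn_integral_rotate_aux f) auto
  moreover have "d * (cnj d * c * w) = c * w" for w
    using d(1) complex_norm_square[of d] by (simp flip: mult.assoc)
  ultimately show ?thesis by (simp only:)
qed

text \<open>Fubini's theorem and rotation invariance; this takes the place of polar coordinates.\<close>

lemma nn_integral_circle_average:
  fixes f :: "complex \<Rightarrow> ennreal"
  assumes f [measurable]: "f \<in> borel_measurable borel"
  shows "(\<integral>\<^sup>+w. (\<integral>\<^sup>+t\<in>{0..2*pi}. f (w * cis t) \<partial>lborel) \<partial>lborel) = ennreal (2 * pi) * (\<integral>\<^sup>+w. f w \<partial>lborel)"
proof -
  have "(\<lambda>p::complex \<times> real. fst p * cis (snd p)) \<in> borel_measurable (borel \<Otimes>\<^sub>M borel)"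
    unfolding borel_prod by (intro borel_measurable_continuous_onI continuous_intros)
  from measurable_compose[OF this f]
  have m [measurable]: "(\<lambda>(w, t). f (w * cis t)) \<in> borel_measurable (borel \<Otimes>\<^sub>M borel)"
    by (simp add: case_prod_unfold)
  have "(\<integral>\<^sup>+w. (\<integral>\<^sup>+t\<in>{0..2*pi}. f (w * cis t) \<partial>lborel) \<partial>lborel)
     = (\<integral>\<^sup>+t. (\<integral>\<^sup>+w. f (w * cis t) * indicator {0..2*pi} t \<partial>lborel) \<partial>lborel)"
    by (rule pair_sigma_finite.Fubini'[OF pair_sigma_finite.intro]) (unfold_locales, measurable)
  also have "\<dots> = (\<integral>\<^sup>+t. (\<integral>\<^sup>+w. f w \<partial>lborel) * indicator {0..2*pi} t \<partial>lborel)"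
  proof (intro nn_integral_cong)
    fix t
    have [measurable]: "(\<lambda>w. f (w * cis t)) \<in> borel_measurable borel"
      by (rule measurable_compose[OF _ f]) (intro borel_measurable_continuous_onI continuous_intros)
    have "(\<integral>\<^sup>+w. f (w * cis t) * indicator {0..2*pi} t \<partial>lborel) = (\<integral>\<^sup>+w. f (w * cis t) \<partial>lborel) * indicator {0..2*pi} t"
      by (rule nn_integral_multc) measurable
    also have "(\<integral>\<^sup>+w. f (w * cis t) \<partial>lborel) = (\<integral>\<^sup>+w. f w \<partial>lborel)"
      using nn_integral_rotate[OF f, of "cis t"] by (simp add: mult.commute)
    finally show "(\<integral>\<^sup>+w. f (w * cis t) * indicator {0..2*pi} t \<partial>lborel) = (\<integral>\<^sup>+w. f w \<partial>lborel) * indicator {0..2*pi} t" .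
  qed
  also have "\<dots> = (\<integral>\<^sup>+w. f w \<partial>lborel) * ennreal (2 * pi)"
    by (simp add: nn_integral_cmult_indicator)
  finally show ?thesis by (simp add: mult.commute)
qed


section \<open>Local estimates for bianalytic functions\<close>

text \<open>Integrate \<open>0 \<le> |G - \<mu>|^2\<close>.\<close>

lemma norm_mean_le_mean_square:
  fixes G :: "real \<Rightarrow> complex" and \<mu> :: complex
  assumes G: "continuous_on {0..2*pi} G" and mean: "(G has_integral 2 * pi * \<mu>) {0..2*pi}"
  shows "2 * pi * (cmod \<mu>)\<^sup>2 \<le> integral {0..2*pi} (\<lambda>t. (cmod (G t))\<^sup>2)"
proof -
  have "((\<lambda>t. G t * cnj \<mu>) has_integral 2 * pi * \<mu> * cnj \<mu>) {0..2*pi}"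
    by (rule has_integral_mult_left[OF mean])
  from has_integral_linear[OF this bounded_linear_Re]
  have "((\<lambda>t. Re (G t * cnj \<mu>)) has_integral Re (2 * pi * \<mu> * cnj \<mu>)) {0..2*pi}" by (simp add: o_def)
  also have "2 * pi * \<mu> * cnj \<mu> = of_real (2 * pi * (cmod \<mu>)\<^sup>2)"
    using complex_norm_square[of \<mu>] by (subst mult.assoc) (simp only: of_real_mult)
  finally have "((\<lambda>t. 2 * Re (G t * cnj \<mu>) - (cmod \<mu>)\<^sup>2) has_integral 2 * Re (of_real (2 * pi * (cmod \<mu>)\<^sup>2)) - 2 * pi * (cmod \<mu>)\<^sup>2) {0..2*pi}"
    using has_integral_const_real[of "(cmod \<mu>)\<^sup>2" 0 "2*pi"] by (intro has_integral_diff has_integral_mult_right) simp_all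
  moreover have "((\<lambda>t. (cmod (G t))\<^sup>2) has_integral integral {0..2*pi} (\<lambda>t. (cmod (G t))\<^sup>2)) {0..2*pi}"
    by (intro integrable_integral integrable_continuous_real continuous_intros G)
  moreover have "2 * Re (x * cnj \<mu>) - (cmod \<mu>)\<^sup>2 \<le> (cmod x)\<^sup>2" for x
  proof -
    have "0 \<le> (cmod (x - \<mu>))\<^sup>2" by simp
    also have "\<dots> = (cmod x)\<^sup>2 - 2 * Re (x * cnj \<mu>) + (cmod \<mu>)\<^sup>2"
      by (simp only: cmod_power2) (simp add: power2_eq_square algebra_simps)
    finally show ?thesis by simp
  qed
  ultimately have "2 * Re (of_real (2 * pi * (cmod \<mu>)\<^sup>2)) - 2 * pi * (cmod \<mu>)\<^sup>2 \<le> integral {0..2*pi} (\<lambda>t. (cmod (G t))\<^sup>2)"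
    by (rule has_integral_le)
  then show ?thesis by simp
qed

lemma entire_circle_mean:
  fixes f :: "complex \<Rightarrow> complex"
  shows "f holomorphic_on UNIV \<Longrightarrow> ((\<lambda>t. f (cis t)) has_integral 2 * pi * f 0) {0..2*pi}"
  by (rule holomorphic_unit_circle_mean[of f UNIV]) auto

text \<open>Two Fourier coefficients of \<open>t \<mapsto> F (w * cis t)\<close>. The one at frequency \<open>-1\<close> is \<open>cnj w * F2 0\<close>. The mean is
  \<open>F1 0\<close> plus the contribution \<open>|w|^2 * deriv F2 0\<close> of the linear term of \<open>F2\<close>. Each is bounded by the mean square.\<close>

lemma bianalytic_circle_estimates:
  assumes F1: "F1 holomorphic_on UNIV" and F2: "F2 holomorphic_on UNIV"
  defines "F \<equiv> \<lambda>w. F1 w + cnj w * F2 w"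
  shows "2 * pi * ((cmod w)\<^sup>2 * (cmod (F2 0))\<^sup>2) \<le> integral {0..2*pi} (\<lambda>t. (cmod (F (w * cis t)))\<^sup>2)"
    and "2 * pi * (cmod (F1 0 + of_real ((cmod w)\<^sup>2) * deriv F2 0))\<^sup>2 \<le> integral {0..2*pi} (\<lambda>t. (cmod (F (w * cis t)))\<^sup>2)"
proof -
  have cF [continuous_intros]: "continuous_on A (\<lambda>t. F (w * cis t))" for A
    unfolding F_def
    by (intro continuous_intros continuous_on_compose2[OF holomorphic_on_imp_continuous_on[OF F1]]
        continuous_on_compose2[OF holomorphic_on_imp_continuous_on[OF F2]]) auto
  have comp: "(\<lambda>u. f (w * u)) holomorphic_on UNIV" if "f holomorphic_on UNIV" for f
    using holomorphic_on_compose_gen[OF _ that, of "\<lambda>u. w * u" UNIV] by (auto simp: o_def intro: holomorphic_intros)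
  have "(\<lambda>u. u * F1 (w * u) + cnj w * F2 (w * u)) holomorphic_on UNIV"
    by (intro holomorphic_intros comp F1 F2)
  from entire_circle_mean[OF this]
  have "((\<lambda>t. cis t * F1 (w * cis t) + cnj w * F2 (w * cis t)) has_integral 2 * pi * (cnj w * F2 0)) {0..2*pi}" by simp
  moreover have "cis t * F1 (w * cis t) + cnj w * F2 (w * cis t) = cis t * F (w * cis t)" for t
  proof -
    have "cis t * F (w * cis t) = cis t * F1 (w * cis t) + cnj w * (cis t * cnj (cis t)) * F2 (w * cis t)"
      unfolding F_def by (simp add: algebra_simps)
    also have "cis t * cnj (cis t) = 1" by (simp add: cis_cnj cis_mult)
    finally show ?thesis by simp
  qed
  ultimately have "((\<lambda>t. cis t * F (w * cis t)) has_integral 2 * pi * (cnj w * F2 0)) {0..2*pi}" by (simp only:)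
  then have "2 * pi * (cmod (cnj w * F2 0))\<^sup>2 \<le> integral {0..2*pi} (\<lambda>t. (cmod (cis t * F (w * cis t)))\<^sup>2)"
    by (intro norm_mean_le_mean_square continuous_intros)
  then show "2 * pi * ((cmod w)\<^sup>2 * (cmod (F2 0))\<^sup>2) \<le> integral {0..2*pi} (\<lambda>t. (cmod (F (w * cis t)))\<^sup>2)"
    by (simp add: norm_mult power_mult_distrib)
  define H where "H z = (if z = 0 then deriv F2 0 else (F2 z - F2 0) / (z - 0))" for z
  have H: "H holomorphic_on UNIV" unfolding H_def by (rule pole_lemma_open[OF F2]) simp
  have F2H: "F2 z = F2 0 + z * H z" for z by (simp add: H_def)
  have "(\<lambda>u. F1 (w * u) + of_real ((cmod w)\<^sup>2) * H (w * u)) holomorphic_on UNIV"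
    by (intro holomorphic_intros comp F1 H)
  from entire_circle_mean[OF this]
  have 1: "((\<lambda>t. F1 (w * cis t) + of_real ((cmod w)\<^sup>2) * H (w * cis t)) has_integral
      2 * pi * (F1 0 + of_real ((cmod w)\<^sup>2) * deriv F2 0)) {0..2*pi}" by (simp add: H_def)
  have "((\<lambda>t. cis t) has_integral 0) {0..2*pi}"
    using entire_circle_mean[of "\<lambda>z. z"] by simp
  from has_integral_linear[OF this bounded_linear_cnj]
  have "((\<lambda>t. cnj (cis t)) has_integral 0) {0..2*pi}" by (simp add: o_def)
  from has_integral_add[OF 1 has_integral_mult_right[OF this, of "cnj w * F2 0"]]
  have "((\<lambda>t. F1 (w * cis t) + of_real ((cmod w)\<^sup>2) * H (w * cis t) + cnj w * F2 0 * cnj (cis t)) has_integral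
      2 * pi * (F1 0 + of_real ((cmod w)\<^sup>2) * deriv F2 0)) {0..2*pi}" by simp
  moreover have "F1 (w * cis t) + of_real ((cmod w)\<^sup>2) * H (w * cis t) + cnj w * F2 0 * cnj (cis t) = F (w * cis t)" for t
  proof -
    have "F (w * cis t) = F1 (w * cis t) + cnj w * F2 0 * cnj (cis t) + (w * cnj w) * (cis t * cnj (cis t)) * H (w * cis t)"
      unfolding F_def by (subst F2H) (simp add: algebra_simps)
    also have "cis t * cnj (cis t) = 1" by (simp add: cis_cnj cis_mult)
    also have "w * cnj w = of_real ((cmod w)\<^sup>2)" by (rule complex_norm_square[symmetric])
    finally show ?thesis by simp
  qed
  ultimately have "((\<lambda>t. F (w * cis t)) has_integral
      2 * pi * (F1 0 + of_real ((cmod w)\<^sup>2) * deriv F2 0)) {0..2*pi}" by (simp only:)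
  then show "2 * pi * (cmod (F1 0 + of_real ((cmod w)\<^sup>2) * deriv F2 0))\<^sup>2 \<le> integral {0..2*pi} (\<lambda>t. (cmod (F (w * cis t)))\<^sup>2)"
    by (intro norm_mean_le_mean_square continuous_intros)
qed


lemma nn_integral_complex_affine:
  fixes f :: "complex \<Rightarrow> ennreal"
  assumes f [measurable]: "f \<in> borel_measurable borel" and "\<rho> > 0"
  shows "(\<integral>\<^sup>+w. f w \<partial>lborel) = ennreal (\<rho>\<^sup>2) * (\<integral>\<^sup>+w. f (a + of_real \<rho> * w) \<partial>lborel)"
proof -
  have m [measurable]: "(\<lambda>w. a + \<rho> *\<^sub>R w) \<in> borel_measurable borel"
    by (intro borel_measurable_continuous_onI continuous_intros)
  have m2 [measurable]: "(\<lambda>w. f (a + \<rho> *\<^sub>R w)) \<in> borel_measurable borel"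
    by (rule measurable_compose[OF m f])
  have "(\<integral>\<^sup>+w. f w \<partial>lborel) = (\<integral>\<^sup>+w. ennreal (\<rho>\<^sup>2) * f (a + \<rho> *\<^sub>R w) \<partial>lborel)"
    using \<open>\<rho> > 0\<close> by (subst lborel_affine[of \<rho> a]) (simp_all add: nn_integral_density nn_integral_distr)
  also have "\<dots> = ennreal (\<rho>\<^sup>2) * (\<integral>\<^sup>+w. f (a + \<rho> *\<^sub>R w) \<partial>lborel)"
    by (rule nn_integral_cmult) measurable
  finally show ?thesis by (simp add: scaleR_conv_of_real)
qed

lemma nn_integral_unit_disc_mono_circle:
  fixes F :: "complex \<Rightarrow> complex" and g :: "complex \<Rightarrow> real"
  assumes F: "continuous_on UNIV F" and g: "continuous_on UNIV g" "\<And>w. g w \<ge> 0"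
    and le: "\<And>w. 2 * pi * g w \<le> integral {0..2*pi} (\<lambda>t. (cmod (F (w * cis t)))\<^sup>2)"
  shows "(\<integral>\<^sup>+w\<in>ball 0 1. ennreal (g w) \<partial>lborel) \<le> (\<integral>\<^sup>+w\<in>ball 0 1. ennreal ((cmod (F w))\<^sup>2) \<partial>lborel)"
proof -
  have [measurable]: "ball (0::complex) 1 \<in> sets borel" by simp
  have [measurable]: "F \<in> borel_measurable borel" "g \<in> borel_measurable borel"
    using F g by (auto intro: borel_measurable_continuous_onI)
  define \<phi> where "\<phi> w = ennreal ((cmod (F w))\<^sup>2) * indicator (ball 0 1) w" for w
  have [measurable]: "\<phi> \<in> borel_measurable borel" unfolding \<phi>_def by measurable
  have "ennreal (2 * pi) * (\<integral>\<^sup>+w\<in>ball 0 1. ennreal (g w) \<partial>lborel)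
      = (\<integral>\<^sup>+w. ennreal (2 * pi) * (ennreal (g w) * indicator (ball 0 1) w) \<partial>lborel)"
    by (rule nn_integral_cmult[symmetric]) measurable
  also have "\<dots> \<le> (\<integral>\<^sup>+w. (\<integral>\<^sup>+t\<in>{0..2*pi}. \<phi> (w * cis t) \<partial>lborel) \<partial>lborel)"
  proof (intro nn_integral_mono)
    fix w :: complex
    have c: "continuous_on {0..2*pi} (\<lambda>t. (cmod (F (w * cis t)))\<^sup>2)"
      by (intro continuous_intros continuous_on_compose2[OF F]) auto
    show "ennreal (2 * pi) * (ennreal (g w) * indicator (ball 0 1) w) \<le> (\<integral>\<^sup>+t\<in>{0..2*pi}. \<phi> (w * cis t) \<partial>lborel)"
    proof (cases "w \<in> ball 0 1")
      case True
      have "(\<integral>\<^sup>+t\<in>{0..2*pi}. \<phi> (w * cis t) \<partial>lborel) = (\<integral>\<^sup>+t\<in>{0..2*pi}. ennreal ((cmod (F (w * cis t)))\<^sup>2) \<partial>lborel)"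
        using True by (intro nn_integral_cong) (simp add: \<phi>_def norm_mult)
      also have "\<dots> = ennreal (integral {0..2*pi} (\<lambda>t. (cmod (F (w * cis t)))\<^sup>2))"
        by (rule nn_integral_Icc_continuous[OF c]) simp
      also have "\<dots> \<ge> ennreal (2 * pi * g w)" by (intro ennreal_leI le)
      finally show ?thesis using True g(2)[of w] by (simp add: ennreal_mult)
    qed auto
  qed
  also have "\<dots> = ennreal (2 * pi) * (\<integral>\<^sup>+w. \<phi> w \<partial>lborel)"
    by (rule nn_integral_circle_average) measurable
  finally have "ennreal (2 * pi) * (\<integral>\<^sup>+w\<in>ball 0 1. ennreal (g w) \<partial>lborel) \<le> ennreal (2 * pi) * (\<integral>\<^sup>+w. \<phi> w \<partial>lborel)" .
  then show ?thesis
    unfolding \<phi>_def by (subst (asm) ennreal_mult_le_mult_iff) auto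
qed

lemma ennreal_measure_ball: "(\<integral>\<^sup>+w. c * indicator (ball (a::complex) r) w \<partial>lborel) = c * ennreal (measure lborel (ball a r))"
proof -
  have "emeasure lborel (ball a r) \<noteq> top" using emeasure_lborel_ball_finite[of a r] by auto
  from emeasure_eq_ennreal_measure[OF this] show ?thesis by (subst nn_integral_cmult_indicator) auto
qed

text \<open>The circle estimates are integrated over the unit disc. In the second one the unknown term
  \<open>|w|^2 * deriv F2 0\<close> is eliminated by comparing the circles of radius \<open>|w|\<close> and \<open>|w| / 2\<close>.\<close>

lemma bianalytic_unit_disc:
  obtains C :: real where "C > 0"
    "\<And>F1 F2. F1 holomorphic_on UNIV \<Longrightarrow> F2 holomorphic_on UNIV \<Longrightarrow>
      ennreal ((cmod (F1 0))\<^sup>2 + (cmod (F2 0))\<^sup>2)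
        \<le> ennreal C * (\<integral>\<^sup>+w\<in>ball 0 1. ennreal ((cmod (F1 w + cnj w * F2 w))\<^sup>2) \<partial>lborel)"
proof -
  define \<beta> where "\<beta> = measure lborel (ball (0::complex) 1)"
  \<comment> \<open>A lower bound for the integral of \<open>|w|^2\<close>, from a disc inside the unit disc on which \<open>|w| \<ge> 1/4\<close>.\<close>
  define \<kappa> where "\<kappa> = measure lborel (ball (1/2::complex) (1/4)) / 16"
  have pos: "\<beta> > 0" "\<kappa> > 0" unfolding \<beta>_def \<kappa>_def by (auto intro!: content_ball_pos)
  define C where "C = 130 / (9 * \<beta>) + 1 / \<kappa>"
  have "C > 0" unfolding C_def using pos by (intro add_pos_pos) auto
  moreover have "ennreal ((cmod (F1 0))\<^sup>2 + (cmod (F2 0))\<^sup>2)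
        \<le> ennreal C * (\<integral>\<^sup>+w\<in>ball 0 1. ennreal ((cmod (F1 w + cnj w * F2 w))\<^sup>2) \<partial>lborel)"
    if hol: "F1 holomorphic_on UNIV" "F2 holomorphic_on UNIV" for F1 F2 :: "complex \<Rightarrow> complex"
  proof -
    define I where "I = (\<integral>\<^sup>+w\<in>ball 0 1. ennreal ((cmod (F1 w + cnj w * F2 w))\<^sup>2) \<partial>lborel)"
    have [measurable]: "ball (0::complex) r \<in> sets borel" for r by simp
    have cF: "continuous_on UNIV (\<lambda>w. F1 w + cnj w * F2 w)"
      by (intro continuous_intros holomorphic_on_imp_continuous_on hol)
    have a: "ennreal (\<kappa> * (cmod (F2 0))\<^sup>2) \<le> I"
    proof -
      have "ennreal (\<kappa> * (cmod (F2 0))\<^sup>2) = ennreal ((cmod (F2 0))\<^sup>2 / 16) * ennreal (measure lborel (ball (1/2::complex) (1/4)))"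
        by (simp add: \<kappa>_def mult.commute flip: ennreal_mult')
      also have "\<dots> = (\<integral>\<^sup>+w. ennreal ((cmod (F2 0))\<^sup>2 / 16) * indicator (ball (1/2::complex) (1/4)) w \<partial>lborel)"
        by (rule ennreal_measure_ball[symmetric])
      also have "\<dots> \<le> (\<integral>\<^sup>+w\<in>ball 0 1. ennreal ((cmod w)\<^sup>2 * (cmod (F2 0))\<^sup>2) \<partial>lborel)"
      proof (intro nn_integral_mono)
        fix w :: complex
        show "ennreal ((cmod (F2 0))\<^sup>2 / 16) * indicator (ball (1/2) (1/4)) w
          \<le> ennreal ((cmod w)\<^sup>2 * (cmod (F2 0))\<^sup>2) * indicator (ball 0 1) w"
        proof (cases "w \<in> ball (1/2) (1/4)")
          case True
          then have d: "cmod (w - 1/2) < 1/4" by (simp add: dist_norm norm_minus_commute)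
          have "cmod w \<le> cmod (w - 1/2) + cmod (1/2)" using norm_triangle_ineq[of "w - 1/2" "1/2"] by simp
          then have in1: "w \<in> ball 0 1" using d by simp
          have "cmod (1/2) \<le> cmod (w - 1/2) + cmod w"
            using norm_triangle_ineq4[of w "w - 1/2"] by simp
          then have "1/4 \<le> cmod w" using d by simp
          then have "(1/4)\<^sup>2 \<le> (cmod w)\<^sup>2" by (intro power_mono) auto
          then have "(1/4)\<^sup>2 * (cmod (F2 0))\<^sup>2 \<le> (cmod w)\<^sup>2 * (cmod (F2 0))\<^sup>2" by (intro mult_right_mono) auto
          then have "(cmod (F2 0))\<^sup>2 / 16 \<le> (cmod w)\<^sup>2 * (cmod (F2 0))\<^sup>2" by (simp add: power2_eq_square)
          then show ?thesis using True in1 by (simp add: ennreal_leI)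
        qed auto
      qed
      also have "\<dots> \<le> I" unfolding I_def
        by (rule nn_integral_unit_disc_mono_circle[OF cF _ _ bianalytic_circle_estimates(1)[OF hol]])
           (auto intro!: continuous_intros)
      finally show ?thesis .
    qed
    define g where "g w = (cmod (F1 0 + of_real ((cmod w)\<^sup>2) * deriv F2 0))\<^sup>2" for w :: complex
    have cg: "continuous_on UNIV g" unfolding g_def by (intro continuous_intros)
    have gm [measurable]: "g \<in> borel_measurable borel" by (rule borel_measurable_continuous_onI[OF cg])
    have J: "(\<integral>\<^sup>+w\<in>ball 0 1. ennreal (g w) \<partial>lborel) \<le> I" unfolding I_def
      by (rule nn_integral_unit_disc_mono_circle[OF cF cg _ bianalytic_circle_estimates(2)[OF hol, folded g_def]])
         (simp add: g_def)
    have half: "(\<integral>\<^sup>+w\<in>ball 0 1. ennreal (g (w / 2)) \<partial>lborel) \<le> 4 * I"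
    proof -
      have m: "(\<lambda>w. ennreal (g w) * indicator (ball 0 (1/2)) w) \<in> borel_measurable borel"
        by (intro borel_measurable_times_ennreal borel_measurable_indicator measurable_compose[OF gm measurable_ennreal]) simp_all
      have "ennreal ((1/2)\<^sup>2) * (\<integral>\<^sup>+w. ennreal (g (0 + of_real (1/2) * w)) * indicator (ball 0 (1/2)) (0 + of_real (1/2) * w) \<partial>lborel)
          = (\<integral>\<^sup>+w\<in>ball 0 (1/2). ennreal (g w) \<partial>lborel)"
        by (rule nn_integral_complex_affine[OF m, symmetric]) simp
      also have "\<dots> \<le> (\<integral>\<^sup>+w\<in>ball 0 1. ennreal (g w) \<partial>lborel)"
        by (intro nn_integral_mono) (auto simp: indicator_def)
      also note J
      also have "(\<lambda>w. ennreal (g (0 + of_real (1/2) * w)) * indicator (ball 0 (1/2)) (0 + of_real (1/2) * w))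
         = (\<lambda>w. ennreal (g (w / 2)) * indicator (ball 0 1) w)"
        by (auto simp: fun_eq_iff indicator_def norm_mult)
      finally have "ennreal ((1/2)\<^sup>2) * (\<integral>\<^sup>+w\<in>ball 0 1. ennreal (g (w / 2)) \<partial>lborel) \<le> I" .
      then have "4 * (ennreal ((1/2)\<^sup>2) * (\<integral>\<^sup>+w\<in>ball 0 1. ennreal (g (w / 2)) \<partial>lborel)) \<le> 4 * I"
        by (rule mult_left_mono) simp
      moreover have "(4::ennreal) * ennreal ((1/2)\<^sup>2) = 1"
      proof -
        have "ennreal 4 * ennreal ((1/2)\<^sup>2) = ennreal (4 * (1/2)\<^sup>2)" by (rule ennreal_mult[symmetric]) auto
        then show ?thesis by (simp add: power2_eq_square)
      qed
      ultimately show ?thesis by (simp flip: mult.assoc)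
    qed
    have b: "ennreal (9 * \<beta> * (cmod (F1 0))\<^sup>2) \<le> 130 * I"
    proof -
      have pw: "9 * (cmod (F1 0))\<^sup>2 \<le> 32 * g (w / 2) + 2 * g w" for w
      proof -
        define x where "x = F1 0 + of_real ((cmod (w / 2))\<^sup>2) * deriv F2 0"
        define y where "y = F1 0 + of_real ((cmod w)\<^sup>2) * deriv F2 0"
        have "of_real ((cmod (w / 2))\<^sup>2) = (of_real ((cmod w)\<^sup>2) / 4 :: complex)"
          by (simp add: norm_divide power_divide)
        then have "3 * F1 0 = 4 * x - y" by (simp add: x_def y_def algebra_simps)
        then have "3 * cmod (F1 0) \<le> 4 * cmod x + cmod y"
          using norm_triangle_ineq4[of "4 * x" y] by (metis norm_mult norm_numeral)
        then have "(3 * cmod (F1 0))\<^sup>2 \<le> (4 * cmod x + cmod y)\<^sup>2" by (intro power_mono) auto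
        also have "\<dots> \<le> 32 * (cmod x)\<^sup>2 + 2 * (cmod y)\<^sup>2"
          using sum_squares_bound[of "4 * cmod x" "cmod y"] by (simp add: power2_sum)
        finally show ?thesis by (simp add: g_def x_def y_def power_mult_distrib)
      qed
      have "ennreal (9 * \<beta> * (cmod (F1 0))\<^sup>2) = ennreal (9 * (cmod (F1 0))\<^sup>2) * ennreal \<beta>"
        using pos by (subst ennreal_mult[symmetric]) (auto simp: mult_ac)
      also have "\<dots> = (\<integral>\<^sup>+w. ennreal (9 * (cmod (F1 0))\<^sup>2) * indicator (ball (0::complex) 1) w \<partial>lborel)"
        unfolding \<beta>_def by (rule ennreal_measure_ball[symmetric])
      also have "\<dots> \<le> (\<integral>\<^sup>+w. 32 * (ennreal (g (w / 2)) * indicator (ball 0 1) w) + 2 * (ennreal (g w) * indicator (ball 0 1) w) \<partial>lborel)"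
      proof (intro nn_integral_mono)
        fix w :: complex
        have "ennreal (9 * (cmod (F1 0))\<^sup>2) \<le> ennreal (32 * g (w / 2) + 2 * g w)" by (intro ennreal_leI pw)
        also have "\<dots> = 32 * ennreal (g (w / 2)) + 2 * ennreal (g w)"
          by (simp add: g_def ennreal_plus ennreal_mult)
        finally show "ennreal (9 * (cmod (F1 0))\<^sup>2) * indicator (ball (0::complex) 1) w
          \<le> 32 * (ennreal (g (w / 2)) * indicator (ball 0 1) w) + 2 * (ennreal (g w) * indicator (ball 0 1) w)"
          by (cases "w \<in> ball 0 1") auto
      qed
      also have "\<dots> = 32 * (\<integral>\<^sup>+w\<in>ball 0 1. ennreal (g (w / 2)) \<partial>lborel) + 2 * (\<integral>\<^sup>+w\<in>ball 0 1. ennreal (g w) \<partial>lborel)"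
      proof -
        have [measurable]: "(\<lambda>w. g (w / 2)) \<in> borel_measurable borel"
          by (intro borel_measurable_continuous_onI continuous_on_compose2[OF cg] continuous_intros) auto
        show ?thesis by (subst nn_integral_add) (simp_all add: nn_integral_cmult)
      qed
      also have "\<dots> \<le> 32 * (4 * I) + 2 * I" by (intro add_mono mult_left_mono half J) auto
      also have "\<dots> = 130 * I" by (simp flip: distrib_right mult.assoc)
      finally show ?thesis .
    qed
    show ?thesis
    proof (cases I)
      case top
      then show ?thesis using \<open>C > 0\<close> by (simp add: I_def[symmetric] ennreal_mult_top)
    next
      case (real i)
      have a': "\<kappa> * (cmod (F2 0))\<^sup>2 \<le> i" using a real by (simp add: ennreal_le_iff)
      have "ennreal (9 * \<beta> * (cmod (F1 0))\<^sup>2) \<le> ennreal (130 * i)" using b real by (simp add: ennreal_mult)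
      then have b': "9 * \<beta> * (cmod (F1 0))\<^sup>2 \<le> 130 * i" using real(1) by (subst (asm) ennreal_le_iff) auto
      have "(cmod (F1 0))\<^sup>2 \<le> 130 / (9 * \<beta>) * i" using b' pos by (simp add: field_simps)
      moreover have "(cmod (F2 0))\<^sup>2 \<le> 1 / \<kappa> * i" using a' pos by (simp add: field_simps)
      ultimately have "(cmod (F1 0))\<^sup>2 + (cmod (F2 0))\<^sup>2 \<le> C * i" by (simp add: C_def distrib_right)
      then have "ennreal ((cmod (F1 0))\<^sup>2 + (cmod (F2 0))\<^sup>2) \<le> ennreal (C * i)" by (rule ennreal_leI)
      then show ?thesis using real \<open>C > 0\<close> by (simp add: I_def[symmetric] ennreal_mult)
    qed
  qed
  ultimately show ?thesis using that by blast
qed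

lemma C2_smooth_continuous: "C2_smooth Q \<Longrightarrow> continuous_on UNIV Q"
  unfolding C2_smooth_def
  by (metis continuous_at_imp_continuous_on has_derivative_continuous)

text \<open>The linear part is written as the real part of a complex linear function, so that it becomes the logarithm
  of the modulus of an entire function.\<close>

lemma C2_smooth_taylor_upper:
  assumes "C2_smooth Q"
  obtains L :: "complex \<Rightarrow> complex" and M :: real where
    "\<And>a w. cmod a \<le> R \<Longrightarrow> cmod (w - a) \<le> 1 \<Longrightarrow>
       Q w \<le> Q a + Re (L a * (w - a)) + M * (cmod (w - a))\<^sup>2" "M \<ge> 0"
proof -
  obtain Q' :: "complex \<Rightarrow> complex \<Rightarrow>\<^sub>L real" and Q'' :: "complex \<Rightarrow> complex \<Rightarrow>\<^sub>L (complex \<Rightarrow>\<^sub>L real)"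
    where Q': "\<And>z. (Q has_derivative blinfun_apply (Q' z)) (at z)"
      and Q'': "\<And>z. (Q' has_derivative blinfun_apply (Q'' z)) (at z)"
      and cont: "continuous_on UNIV Q''"
    using assms unfolding C2_smooth_def by blast
  have "bounded (Q'' ` cball 0 (R + 1))"
    by (intro compact_imp_bounded compact_continuous_image continuous_on_subset[OF cont]) auto
  then obtain B where B: "\<And>x. x \<in> cball 0 (R + 1) \<Longrightarrow> norm (Q'' x) \<le> B"
    by (meson bounded_iff imageI)
  define M where "M = max B 0"
  define L where "L a = Complex (Q' a 1) (- Q' a \<i>)" for a
  have Lv: "Re (L a * v) = Q' a v" for a v
  proof -
    have "v = Re v *\<^sub>R 1 + Im v *\<^sub>R \<i>" by (simp add: complex_eq_iff)
    then have "Q' a v = Q' a (Re v *\<^sub>R 1 + Im v *\<^sub>R \<i>)" by simp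
    also have "\<dots> = Re v * Q' a 1 + Im v * Q' a \<i>"
      by (simp only: blinfun.add_right blinfun.scaleR_right real_scaleR_def)
    finally show ?thesis by (simp add: L_def)
  qed
  have "Q w \<le> Q a + Re (L a * (w - a)) + M * (cmod (w - a))\<^sup>2"
    if a: "cmod a \<le> R" and w: "cmod (w - a) \<le> 1" for a w
  proof -
    define S where "S = cball a (cmod (w - a))"
    have SB: "norm (Q'' x) \<le> M" if "x \<in> S" for x
    proof -
      have "cmod x \<le> cmod a + cmod (x - a)" using norm_triangle_ineq[of a "x - a"] by simp
      also have "cmod (x - a) \<le> 1" using that w by (simp add: S_def dist_norm norm_minus_commute)
      finally have "x \<in> cball 0 (R + 1)" using a by simp
      from B[OF this] show ?thesis by (simp add: M_def)
    qed
    have Q'lip: "norm (Q' x - Q' a) \<le> M * cmod (w - a)" if x: "x \<in> S" for x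
    proof -
      have "norm (Q' x - Q' a) \<le> M * norm (x - a)"
      proof (rule differentiable_bound[of S Q' "\<lambda>z. blinfun_apply (Q'' z)"])
        show "convex S" unfolding S_def by simp
        show "(Q' has_derivative blinfun_apply (Q'' y)) (at y within S)" for y
          by (rule has_derivative_at_withinI[OF Q''])
        show "onorm (blinfun_apply (Q'' y)) \<le> M" if "y \<in> S" for y
          using SB[OF that] by (simp add: norm_blinfun.rep_eq)
        show "x \<in> S" by fact
        show "a \<in> S" by (simp add: S_def)
      qed
      also have "\<dots> \<le> M * cmod (w - a)"
        using x by (intro mult_left_mono) (auto simp: S_def dist_norm norm_minus_commute M_def)
      finally show ?thesis .
    qed
    have "norm (Q w - Q a - Q' a (w - a)) \<le> norm (w - a) * (M * cmod (w - a))"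
    proof (rule differentiable_bound_linearization[where S=S])
      show "a + t *\<^sub>R (w - a) \<in> S" if "t \<in> {0..1}" for t
        using that by (simp add: S_def dist_norm mult_left_le_one_le)
      show "(Q has_derivative blinfun_apply (Q' x)) (at x within S)" for x
        by (rule has_derivative_at_withinI[OF Q'])
      show "onorm (blinfun_apply (Q' x) - blinfun_apply (Q' a)) \<le> M * cmod (w - a)" if "x \<in> S" for x
      proof -
        have "blinfun_apply (Q' x) - blinfun_apply (Q' a) = blinfun_apply (Q' x - Q' a)"
          by (simp add: fun_eq_iff blinfun.diff_left)
        then show ?thesis using Q'lip[OF that] by (simp add: norm_blinfun.rep_eq)
      qed
      show "a \<in> S" by (simp add: S_def)
    qed
    then show ?thesis unfolding Lv by (simp add: power2_eq_square mult_ac)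
  qed
  then show ?thesis using that[of L M] by (simp add: M_def)
qed

text \<open>The unit disc estimate is applied after the substitution \<open>w = a + u / sqrt m\<close>, to \<open>f\<close> multiplied by the entire
  function \<open>h w = exp (- (m / 2) * L a * (w - a))\<close>. On the disc of radius \<open>1 / sqrt m\<close> the quadratic remainder
  of Taylor's formula contributes at most \<open>m * M * (1 / m) = M\<close> to the exponent.\<close>

lemma bianalytic_weighted_pointwise:
  assumes Q: "C2_smooth Q"
  obtains C :: real where "C > 0"
    "\<And>m a f1 f2 N. m \<ge> 1 \<Longrightarrow> cmod a \<le> R \<Longrightarrow> f1 holomorphic_on UNIV \<Longrightarrow> f2 holomorphic_on UNIV \<Longrightarrow> N \<ge> 0 \<Longrightarrow>
      (\<integral>\<^sup>+w. ennreal ((cmod (f1 w + cnj w * f2 w))\<^sup>2 * exp (- m * Q w)) \<partial>lborel) \<le> ennreal N \<Longrightarrow>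
      (cmod (f1 a + cnj a * f2 a))\<^sup>2 + (cmod (f2 a))\<^sup>2 / m \<le> C * m * exp (m * Q a) * N"
proof -
  obtain L M where LM: "\<And>a w. cmod a \<le> R \<Longrightarrow> cmod (w - a) \<le> 1 \<Longrightarrow>
       Q w \<le> Q a + Re (L a * (w - a)) + M * (cmod (w - a))\<^sup>2" and M: "M \<ge> 0"
    using C2_smooth_taylor_upper[OF Q] by blast
  obtain C0 :: real where C0: "C0 > 0" "\<And>F1 F2. F1 holomorphic_on UNIV \<Longrightarrow> F2 holomorphic_on UNIV \<Longrightarrow>
      ennreal ((cmod (F1 0))\<^sup>2 + (cmod (F2 0))\<^sup>2)
        \<le> ennreal C0 * (\<integral>\<^sup>+w\<in>ball 0 1. ennreal ((cmod (F1 w + cnj w * F2 w))\<^sup>2) \<partial>lborel)"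
    using bianalytic_unit_disc by blast
  have "(cmod (f1 a + cnj a * f2 a))\<^sup>2 + (cmod (f2 a))\<^sup>2 / m \<le> C0 * exp M * m * exp (m * Q a) * N"
    if m: "m \<ge> 1" and a: "cmod a \<le> R" and hol: "f1 holomorphic_on UNIV" "f2 holomorphic_on UNIV" and N: "N \<ge> 0"
      and int: "(\<integral>\<^sup>+w. ennreal ((cmod (f1 w + cnj w * f2 w))\<^sup>2 * exp (- m * Q w)) \<partial>lborel) \<le> ennreal N"
    for m a f1 f2 N
  proof -
    define \<rho> where "\<rho> = 1 / sqrt m"
    have \<rho>: "\<rho> > 0" "\<rho> \<le> 1" "\<rho>\<^sup>2 = 1 / m" using m by (auto simp: \<rho>_def power_divide)
    define h where "h w = exp (- (of_real m / 2) * L a * (w - a))" for w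
    define f where "f w = f1 w + cnj w * f2 w" for w
    define s where "s u = a + of_real \<rho> * u" for u
    define F1 where "F1 u = (f1 (s u) + cnj a * f2 (s u)) * h (s u)" for u
    define F2 where "F2 u = of_real \<rho> * f2 (s u) * h (s u)" for u
    have F: "F1 u + cnj u * F2 u = f (s u) * h (s u)" for u
      by (simp add: F1_def F2_def f_def s_def algebra_simps)
    have hs: "s holomorphic_on UNIV" unfolding s_def by (intro holomorphic_intros)
    have comp: "(\<lambda>u. g (s u)) holomorphic_on UNIV" if "g holomorphic_on UNIV" for g
      using holomorphic_on_compose_gen[OF hs that] by (simp add: o_def)
    have hh: "h holomorphic_on UNIV" unfolding h_def by (intro holomorphic_intros)
    have F12: "F1 holomorphic_on UNIV" "F2 holomorphic_on UNIV"
      unfolding F1_def F2_def by (intro holomorphic_intros comp hol hh)+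
    have cf: "continuous_on UNIV f"
      unfolding f_def by (intro continuous_intros holomorphic_on_imp_continuous_on hol)
    have cQ: "continuous_on UNIV Q" by (rule C2_smooth_continuous[OF Q])
    define G where "G w = ennreal ((cmod (f w))\<^sup>2 * exp (- m * Q w))" for w
    have Gm: "G \<in> borel_measurable borel"
      unfolding G_def
      by (intro measurable_compose[OF borel_measurable_continuous_onI measurable_ennreal] continuous_intros cf cQ)
    have Gsm [measurable]: "(\<lambda>u. G (s u)) \<in> borel_measurable borel"
      by (rule measurable_compose[OF borel_measurable_continuous_onI Gm])
         (auto simp: s_def intro!: continuous_intros)
    have pw: "(cmod (f (s u) * h (s u)))\<^sup>2 \<le> exp (m * Q a + M) * ((cmod (f (s u)))\<^sup>2 * exp (- m * Q (s u)))"
      if u: "cmod u < 1" for u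
    proof -
      have d: "cmod (s u - a) = \<rho> * cmod u" using \<rho> by (simp add: s_def norm_mult)
      have d1: "\<rho> * cmod u \<le> 1" using \<rho> u by (intro mult_le_one) auto
      have "Q (s u) \<le> Q a + Re (L a * (s u - a)) + M * (\<rho> * cmod u)\<^sup>2"
        using LM[OF a, of "s u"] d d1 by simp
      then have "m * Q (s u) \<le> m * (Q a + Re (L a * (s u - a)) + M * (\<rho> * cmod u)\<^sup>2)"
        using m by (intro mult_left_mono) auto
      also have "m * (M * (\<rho> * cmod u)\<^sup>2) \<le> M"
      proof -
        have "m * (M * (\<rho> * cmod u)\<^sup>2) = M * (cmod u)\<^sup>2" using m by (simp add: power_mult_distrib \<rho>(3))
        also have "\<dots> \<le> M * 1" using u M by (intro mult_left_mono power_le_one) auto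
        finally show ?thesis by simp
      qed
      then have "m * (Q a + Re (L a * (s u - a)) + M * (\<rho> * cmod u)\<^sup>2) \<le> m * Q a + m * Re (L a * (s u - a)) + M"
        by (simp add: algebra_simps)
      finally have le: "- m * Re (L a * (s u - a)) \<le> m * Q a + M - m * Q (s u)" by simp
      have "(cmod (h (s u)))\<^sup>2 = exp (- m * Re (L a * (s u - a)))"
        by (simp add: h_def norm_exp_eq_Re power2_eq_square mult.assoc flip: exp_add)
      also have "\<dots> \<le> exp (m * Q a + M - m * Q (s u))" using le by simp
      also have "\<dots> = exp (m * Q a + M) * exp (- m * Q (s u))" by (simp flip: exp_add)
      finally have "(cmod (f (s u)))\<^sup>2 * (cmod (h (s u)))\<^sup>2 \<le> (cmod (f (s u)))\<^sup>2 * (exp (m * Q a + M) * exp (- m * Q (s u)))"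
        by (intro mult_left_mono) auto
      then show ?thesis by (simp add: norm_mult power_mult_distrib mult_ac)
    qed
    have "ennreal ((cmod (F1 0))\<^sup>2 + (cmod (F2 0))\<^sup>2)
        \<le> ennreal C0 * (\<integral>\<^sup>+u\<in>ball 0 1. ennreal ((cmod (f (s u) * h (s u)))\<^sup>2) \<partial>lborel)"
      using C0(2)[OF F12] by (simp only: F)
    also have "(\<integral>\<^sup>+u\<in>ball 0 1. ennreal ((cmod (f (s u) * h (s u)))\<^sup>2) \<partial>lborel)
        \<le> (\<integral>\<^sup>+u. ennreal (exp (m * Q a + M)) * G (s u) \<partial>lborel)"
    proof (intro nn_integral_mono)
      fix u :: complex
      show "ennreal ((cmod (f (s u) * h (s u)))\<^sup>2) * indicator (ball 0 1) u \<le> ennreal (exp (m * Q a + M)) * G (s u)"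
        using ennreal_leI[OF pw[of u]] by (cases "u \<in> ball 0 1") (simp_all add: G_def ennreal_mult)
    qed
    also have "\<dots> = ennreal (exp (m * Q a + M)) * (\<integral>\<^sup>+u. G (s u) \<partial>lborel)"
      by (rule nn_integral_cmult) measurable
    also have "(\<integral>\<^sup>+u. G (s u) \<partial>lborel) = ennreal m * (ennreal (\<rho>\<^sup>2) * (\<integral>\<^sup>+u. G (s u) \<partial>lborel))"
    proof -
      have "ennreal m * ennreal (\<rho>\<^sup>2) = 1" using m by (simp add: \<rho>(3) flip: ennreal_mult)
      then show ?thesis by (simp flip: mult.assoc)
    qed
    also have "ennreal (\<rho>\<^sup>2) * (\<integral>\<^sup>+u. G (s u) \<partial>lborel) = (\<integral>\<^sup>+w. G w \<partial>lborel)"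
      unfolding s_def by (rule nn_integral_complex_affine[symmetric, OF Gm \<rho>(1)])
    also have "\<dots> \<le> ennreal N" using int by (simp add: G_def f_def)
    finally have "ennreal ((cmod (F1 0))\<^sup>2 + (cmod (F2 0))\<^sup>2) \<le> ennreal C0 * (ennreal (exp (m * Q a + M)) * (ennreal m * ennreal N))"
      by (simp add: mult_left_mono)
    also have "\<dots> = ennreal (C0 * (exp (m * Q a + M) * (m * N)))"
      using C0(1) m N by (simp add: ennreal_mult)
    finally have "(cmod (F1 0))\<^sup>2 + (cmod (F2 0))\<^sup>2 \<le> C0 * (exp (m * Q a + M) * (m * N))"
      using C0(1) m N by (subst (asm) ennreal_le_iff) auto
    moreover have "F1 0 = f1 a + cnj a * f2 a" by (simp add: F1_def s_def h_def)
    moreover have "(cmod (F2 0))\<^sup>2 = (cmod (f2 a))\<^sup>2 / m"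
      by (simp add: F2_def s_def h_def norm_mult power_mult_distrib \<rho>(3))
    ultimately show ?thesis by (simp add: exp_add mult_ac)
  qed
  then show ?thesis using that[of "C0 * exp M"] C0(1) by simp
qed

section \<open>Polynomials and the equilibrium weight\<close>

lemma poly_norm_le_power:
  fixes p :: "complex poly"
  assumes "cmod z \<ge> 1"
  shows "cmod (poly p z) \<le> (\<Sum>i\<le>degree p. cmod (coeff p i)) * cmod z ^ degree p"
proof -
  have "cmod (poly p z) \<le> (\<Sum>i\<le>degree p. cmod (coeff p i * z ^ i))"
    unfolding poly_altdef by (rule norm_sum)
  also have "\<dots> \<le> (\<Sum>i\<le>degree p. cmod (coeff p i) * cmod z ^ degree p)"
    using assms by (intro sum_mono) (auto simp: norm_mult norm_power intro!: mult_left_mono power_increasing)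
  finally show ?thesis by (simp add: sum_distrib_right)
qed

text \<open>The radius \<open>R0\<close> is chosen so that outside the corresponding disc the bound \<open>B + 2 * ln |z|\<close> of the maximum
  principle is below \<open>Q\<close>; this is possible because \<open>Q\<close> grows like \<open>(1 + \<epsilon>) * ln |z|^2\<close>. It does not depend
  on \<open>m\<close>, \<open>p\<close> and \<open>A\<close>.\<close>

lemma poly_le_exp_equilibrium_weight:
  fixes Q :: "complex \<Rightarrow> real"
  assumes cQ: "continuous_on UNIV Q" and "\<epsilon> > 0"
    and growth: "\<And>z. cmod z \<ge> C0 \<Longrightarrow> Q z \<ge> (1 + \<epsilon>) * ln ((cmod z)\<^sup>2)"
  obtains R0 :: real where "R0 \<ge> 1"
    "\<And>m p A z. m \<ge> 1 \<Longrightarrow> real (degree p) \<le> m \<Longrightarrow> A > 0 \<Longrightarrow>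
       (\<And>z. cmod z \<le> R0 \<Longrightarrow> (cmod (poly p z))\<^sup>2 \<le> A * exp (m * Q z)) \<Longrightarrow>
       (cmod (poly p z))\<^sup>2 \<le> A * exp (m * real_of_ereal (equilibrium_weight Q z))"
proof -
  define R1 where "R1 = max C0 1"
  have "bounded (Q ` cball 0 R1)"
    by (intro compact_imp_bounded compact_continuous_image continuous_on_subset[OF cQ]) auto
  then obtain B where "\<And>x. x \<in> cball 0 R1 \<Longrightarrow> norm (Q x) \<le> B"
    by (meson bounded_iff imageI)
  then have B: "\<And>x. x \<in> cball 0 R1 \<Longrightarrow> \<bar>Q x\<bar> \<le> B" by simp
  have "0 \<in> cball (0::complex) R1" by (simp add: R1_def le_max_iff_disj)
  from B[OF this] have B0: "B \<ge> 0" by simp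
  define c where "c = B + ln (R1\<^sup>2)"
  define ll where "ll z = ln (max (1 * (cmod (poly [:0, 1:] z))\<^sup>2) 1)" for z :: complex
  have ll1: "ll z = ln ((cmod z)\<^sup>2)" "ln ((cmod z)\<^sup>2) = 2 * ln (cmod z)" "0 \<le> ln (cmod z)" if "cmod z \<ge> 1" for z
  proof -
    have "(cmod z)\<^sup>2 \<ge> 1" using that by (rule one_le_power)
    then show "ll z = ln ((cmod z)\<^sup>2)" by (simp add: ll_def)
    show "ln ((cmod z)\<^sup>2) = 2 * ln (cmod z)" "0 \<le> ln (cmod z)" using that by (auto simp: ln_realpow)
  qed
  have ll0: "ll z \<ge> 0" for z by (simp add: ll_def)
  have lowQ: "ll z - c \<le> Q z" for z
  proof (cases "cmod z \<le> R1")
    case True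
    have "max ((cmod z)\<^sup>2) 1 \<le> R1\<^sup>2" using True by (auto simp: R1_def intro!: power_mono)
    then have "ll z \<le> ln (R1\<^sup>2)" unfolding ll_def by (intro ln_mono) (auto simp: less_max_iff_disj)
    moreover have "- B \<le> Q z" using B[of z] True by auto
    ultimately show ?thesis by (simp add: c_def)
  next
    case False
    then have z: "cmod z \<ge> C0" "cmod z \<ge> 1" by (auto simp: R1_def)
    have "ll z \<le> (1 + \<epsilon>) * ll z" using ll0[of z] \<open>\<epsilon> > 0\<close> by (simp add: algebra_simps)
    also have "\<dots> \<le> Q z" using growth[OF z(1)] ll1[OF z(2)] by simp
    moreover have "c \<ge> 0" using B0 by (simp add: c_def R1_def)
    ultimately show ?thesis by simp
  qed
  define R0 where "R0 = max R1 (exp (B / (2 * \<epsilon>)))"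
  have R0: "R0 \<ge> 1" by (simp add: R0_def R1_def)
  have farQ: "B + 2 * ln (cmod z) \<le> Q z" if "cmod z > R0" for z
  proof -
    have z: "cmod z \<ge> C0" "cmod z \<ge> 1" "cmod z \<ge> exp (B / (2 * \<epsilon>))" using that by (auto simp: R0_def R1_def)
    have "B / (2 * \<epsilon>) \<le> ln (cmod z)" using z by (subst ln_ge_iff) auto
    then have "B \<le> 2 * \<epsilon> * ln (cmod z)" using \<open>\<epsilon> > 0\<close> by (simp add: field_simps)
    moreover have "(1 + \<epsilon>) * (2 * ln (cmod z)) \<le> Q z" using growth[OF z(1)] ll1[OF z(2)] by simp
    ultimately show ?thesis by (simp add: algebra_simps)
  qed
  have "(cmod (poly p z))\<^sup>2 \<le> A * exp (m * real_of_ereal (equilibrium_weight Q z))"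
    if m: "m \<ge> 1" and deg: "real (degree p) \<le> m" and A: "A > 0"
      and le: "\<And>z. cmod z \<le> R0 \<Longrightarrow> (cmod (poly p z))\<^sup>2 \<le> A * exp (m * Q z)"
    for m p A z
  proof -
    \<comment> \<open>The cutoff makes the competitor at least \<open>- c\<close>, which is still at most \<open>Q\<close>.\<close>
    define \<eta> where "\<eta> = exp (- m * c)"
    have \<eta>: "\<eta> > 0" by (simp add: \<eta>_def)
    define u where "u z = 1 / m * ln (max (1 / A * (cmod (poly p z))\<^sup>2) \<eta>) + 0" for z
    have pos: "max (1 / A * (cmod (poly p z))\<^sup>2) \<eta> > 0" for z using \<eta> by (simp add: less_max_iff_disj)
    have su: "submean u" unfolding u_def using A m \<eta>
      by (intro submean_affine submean_log_max_poly) auto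
    then have cu: "subharmonic (\<lambda>z. ereal (u z))" by (intro subharmonic_continuousI) (auto simp: submean_def)
    have uQ: "u z \<le> Q z" if "cmod z \<le> R0" for z
    proof -
      have "1 / A * (cmod (poly p z))\<^sup>2 \<le> exp (m * Q z)" using le[OF that] A by (simp add: field_simps)
      moreover have "\<eta> \<le> exp (m * Q z)"
      proof -
        have "m * (- c) \<le> m * Q z" using lowQ[of z] ll0[of z] m by (intro mult_left_mono) auto
        then show ?thesis by (simp add: \<eta>_def)
      qed
      ultimately have "ln (max (1 / A * (cmod (poly p z))\<^sup>2) \<eta>) \<le> ln (exp (m * Q z))"
        using pos[of z] by (intro ln_mono) auto
      then show ?thesis using m by (simp add: u_def field_simps)
    qed
    define s where "s = (\<Sum>i\<le>degree p. cmod (coeff p i))"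
    define B1 where "B1 = 1 / m * ln (max (1 / A * s\<^sup>2) \<eta>)"
    have ugrowth: "u z \<le> ln ((cmod z)\<^sup>2) + B1" if z: "cmod z \<ge> 1" for z
    proof -
      let ?k = "(cmod z) ^ (2 * degree p)"
      have k1: "?k \<ge> 1" using z by simp
      have "(cmod (poly p z))\<^sup>2 \<le> (s * cmod z ^ degree p)\<^sup>2"
        unfolding s_def by (intro power_mono poly_norm_le_power z) auto
      then have "1 / A * (cmod (poly p z))\<^sup>2 \<le> 1 / A * (s\<^sup>2 * ?k)"
        using A by (intro mult_left_mono) (auto simp: power_mult_distrib power_mult mult.commute)
      also have "\<dots> = 1 / A * s\<^sup>2 * ?k" by simp
      also have "\<dots> \<le> max (1 / A * s\<^sup>2) \<eta> * ?k" using k1 by (intro mult_right_mono) auto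
      finally have 1: "1 / A * (cmod (poly p z))\<^sup>2 \<le> max (1 / A * s\<^sup>2) \<eta> * ?k" .
      have "\<eta> * 1 \<le> max (1 / A * s\<^sup>2) \<eta> * ?k" using k1 \<eta> by (intro mult_mono) auto
      with 1 have "ln (max (1 / A * (cmod (poly p z))\<^sup>2) \<eta>) \<le> ln (max (1 / A * s\<^sup>2) \<eta> * ?k)"
        using pos[of z] by (intro ln_mono) auto
      also have "\<dots> = ln (max (1 / A * s\<^sup>2) \<eta>) + ln ?k"
        using \<eta> less_le_trans[OF zero_less_one k1] by (intro ln_mult_pos) (auto simp: less_max_iff_disj)
      also have "ln ?k = real (degree p) * (2 * ln (cmod z))" by (simp add: ln_realpow)
      also have "\<dots> \<le> m * (2 * ln (cmod z))" using deg ll1(3)[OF z] by (intro mult_right_mono) auto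
      finally have "1 / m * ln (max (1 / A * (cmod (poly p z))\<^sup>2) \<eta>) \<le> 1 / m * (ln (max (1 / A * s\<^sup>2) \<eta>) + m * (2 * ln (cmod z)))"
        using m by (intro mult_left_mono) auto
      then show ?thesis using m ll1(2)[OF z] by (simp add: u_def B1_def distrib_left)
    qed
    have far1: "\<forall>\<^sub>F z in at_infinity. cmod z \<ge> (1::real)"
      unfolding eventually_at_infinity by (intro exI[of _ 1]) auto
    have uQ': "u z \<le> Q z" for z
    proof (cases "cmod z \<le> R0")
      case False
      then have "ereal (u z) \<le> ereal (B + 2 * ln (cmod z / 1))"
      proof (intro subharmonic_le_outside[OF cu])
        show "ereal (u w) \<le> ereal B" if "cmod w = 1" for w
          using uQ[of w] B[of w] that R0 by (auto simp: R1_def abs_le_iff intro: order_trans)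
        show "\<forall>\<^sub>F z in at_infinity. ereal (u z) \<le> ereal (ln ((cmod z)\<^sup>2) + B1)"
          using far1 by eventually_elim (simp add: ugrowth)
      qed (use R0 in auto)
      then show ?thesis using farQ[of z] False by simp
    qed (rule uQ)
    define v where "v z = max (u z) (1 * ll z + (- c))" for z
    have sv: "submean v" unfolding v_def ll_def
      by (intro submean_max su submean_affine submean_log_max_poly) auto
    have "admissible Q (\<lambda>z. ereal (v z))"
      unfolding admissible_def
    proof (intro conjI allI)
      show "subharmonic (\<lambda>z. ereal (v z))" using sv by (intro subharmonic_continuousI) (auto simp: submean_def)
      show "ereal (v z) \<le> ereal (Q z)" for z using uQ'[of z] lowQ[of z] by (simp add: v_def)
      have "\<forall>\<^sub>F z in at_infinity. \<bar>ereal (v z) - ereal (ln ((cmod z)\<^sup>2))\<bar> \<le> ereal (\<bar>B1\<bar> + \<bar>c\<bar>)"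
        using far1
      proof eventually_elim
        case (elim z)
        have "v z \<le> ln ((cmod z)\<^sup>2) + (\<bar>B1\<bar> + \<bar>c\<bar>)" "ln ((cmod z)\<^sup>2) - (\<bar>B1\<bar> + \<bar>c\<bar>) \<le> v z"
          using ugrowth[OF elim] ll1(1)[OF elim] by (auto simp: v_def)
        then show ?case by (simp add: abs_le_iff)
      qed
      then show "\<exists>B::real. \<forall>\<^sub>F z in at_infinity. \<bar>ereal (v z) - ereal (ln ((cmod z)\<^sup>2))\<bar> \<le> ereal B" by blast
    qed
    then have "v z \<le> real_of_ereal (equilibrium_weight Q z)" by (rule le_equilibrium_weight[OF cQ])
    then have "u z \<le> real_of_ereal (equilibrium_weight Q z)" by (simp add: v_def)
    then have "ln (max (1 / A * (cmod (poly p z))\<^sup>2) \<eta>) \<le> m * real_of_ereal (equilibrium_weight Q z)"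
      using m by (simp add: u_def field_simps)
    then have "max (1 / A * (cmod (poly p z))\<^sup>2) \<eta> \<le> exp (m * real_of_ereal (equilibrium_weight Q z))"
      using exp_ln[OF pos[of z]] by (metis exp_le_cancel_iff)
    then show ?thesis using A by (simp add: field_simps)
  qed
  then show ?thesis using that[of R0] R0 by blast
qed


section \<open>The kernel on the diagonal\<close>

lemma Pol2_poly:
  assumes "f \<in> Pol2 n" "n \<ge> 1"
  obtains p q :: "complex poly" where "degree p < n" "degree q < n" "\<And>z. f z = poly p z + cnj z * poly q z"
proof -
  obtain c where c: "f = (\<lambda>z. \<Sum>r\<in>{0..1::nat}. \<Sum>j<n. c r j * (cnj z ^ r * z ^ j))"
    using assms(1) by (auto simp: Pol2_def)
  define p where "p r = (\<Sum>j<n. monom (c r j) j)" for r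
  have deg: "degree (p r) < n" for r
  proof -
    have "degree (p r) \<le> n - 1" unfolding p_def
      by (intro degree_sum_le) (auto intro!: order_trans[OF degree_monom_le])
    then show ?thesis using assms(2) by simp
  qed
  have "f z = poly (p 0) z + cnj z * poly (p 1) z" for z
  proof -
    have "{0..1::nat} = {0, 1}" by auto
    then show ?thesis by (simp add: c p_def poly_sum poly_monom sum_distrib_left mult_ac)
  qed
  with deg show ?thesis using that by blast
qed

lemma nn_integral_weighted_dA:
  fixes g :: "complex \<Rightarrow> real"
  assumes Q: "continuous_on UNIV Q" and g: "continuous_on UNIV g" "\<And>w. g w \<ge> 0"
    and int: "integrable (weighted_dA m Q) g"
  shows "(\<integral>\<^sup>+w. ennreal (g w * exp (- m * Q w)) \<partial>lborel) = ennreal (pi * (\<integral>w. g w \<partial>weighted_dA m Q))"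
proof -
  have [measurable]: "Q \<in> borel_measurable borel" "g \<in> borel_measurable borel"
    using Q g by (auto intro: borel_measurable_continuous_onI)
  let ?G = "\<lambda>w. ennreal (g w * exp (- m * Q w))"
  have "ennreal (\<integral>w. g w \<partial>weighted_dA m Q) = (\<integral>\<^sup>+w. ennreal (g w) \<partial>weighted_dA m Q)"
    using g(2) by (intro nn_integral_eq_integral[symmetric] int) auto
  also have "\<dots> = (\<integral>\<^sup>+w. ennreal (1 / pi) * (ennreal (exp (- m * Q w)) * ennreal (g w)) \<partial>lborel)"
    unfolding weighted_dA_def dA_def by (simp add: nn_integral_density)
  also have "\<dots> = (\<integral>\<^sup>+w. ennreal (1 / pi) * ?G w \<partial>lborel)"
    using g(2) by (intro nn_integral_cong) (simp add: ennreal_mult mult.commute)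
  also have "\<dots> = ennreal (1 / pi) * (\<integral>\<^sup>+w. ?G w \<partial>lborel)"
    by (rule nn_integral_cmult) measurable
  finally have "ennreal pi * ennreal (\<integral>w. g w \<partial>weighted_dA m Q) = ennreal pi * (ennreal (1 / pi) * (\<integral>\<^sup>+w. ?G w \<partial>lborel))"
    by simp
  moreover have "ennreal pi * ennreal (1 / pi) = 1" by (simp flip: ennreal_mult)
  ultimately show ?thesis by (simp add: ennreal_mult' flip: mult.assoc)
qed

text \<open>The kernel section \<open>f = K(\<cdot>, z)\<close>: by the reproducing property, its value at \<open>z\<close> is its squared norm.\<close>

lemma kernel_extremal_function:
  assumes Q: "continuous_on UNIV Q"
  obtains f where "f \<in> A2 m Q n"
    "f z = K2 m Q n z z" "Im (K2 m Q n z z) = 0" "Re (K2 m Q n z z) \<ge> 0"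
    "(\<integral>w. (cmod (f w))\<^sup>2 \<partial>weighted_dA m Q) = Re (K2 m Q n z z)"
proof -
  obtain d e where e: "orthonormal_basis (weighted_dA m Q) (A2 m Q n) d e"
    using orthonormal_basis_exists[OF Q] by blast
  interpret function_inner_space "weighted_dA m Q" "A2 m Q n"
    by (rule A2_function_inner_space[OF Q])
  have eA: "e j \<in> A2 m Q n" if "j < d" for j using e that by (auto simp: orthonormal_basis_def)
  have K: "K2 m Q n z z = of_real (\<Sum>j<d. (cmod (e j z))\<^sup>2)"
    by (simp add: K2_eq[OF Q e] complex_norm_square del: of_real_power)
  define f where "f = (\<lambda>w. \<Sum>j<d. cnj (e j z) * e j w)"
  have fA: "f \<in> A2 m Q n" unfolding f_def by (intro sum_mem eA)
  have fz: "f z = K2 m Q n z z" by (simp add: f_def K2_eq[OF Q e] mult.commute)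
  have fe: "L2_inner (weighted_dA m Q) f (e k) = cnj (e k z)" if "k < d" for k
  proof -
    have "L2_inner (weighted_dA m Q) f (e k) = (\<Sum>j<d. cnj (e j z) * L2_inner (weighted_dA m Q) (e j) (e k))"
      unfolding f_def by (intro inner_sum eA that)
    also have "\<dots> = (\<Sum>j<d. if j = k then cnj (e j z) else 0)"
      using e that by (intro sum.cong) (auto simp: orthonormal_basis_def)
    finally show ?thesis using that by simp
  qed
  have "L2_inner (weighted_dA m Q) f f = (\<Sum>j<d. cnj (e j z) * L2_inner (weighted_dA m Q) (e j) f)"
    using inner_sum[of d e f "\<lambda>j. cnj (e j z)", OF eA fA] by (simp add: f_def[symmetric])
  also have "\<dots> = (\<Sum>j<d. cnj (e j z) * e j z)"
    using fe by (intro sum.cong) (auto simp: inner_cnj[of _ f])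
  also have "\<dots> = K2 m Q n z z" by (simp add: K2_eq[OF Q e] mult.commute)
  finally have "L2_inner (weighted_dA m Q) f f = K2 m Q n z z" .
  moreover have "L2_inner (weighted_dA m Q) f f = of_real (\<integral>w. (cmod (f w))\<^sup>2 \<partial>weighted_dA m Q)"
    unfolding L2_inner_def complex_norm_square[symmetric] by (rule integral_complex_of_real)
  ultimately have "(\<integral>w. (cmod (f w))\<^sup>2 \<partial>weighted_dA m Q) = Re (K2 m Q n z z)" by (metis Re_complex_of_real)
  then show ?thesis using that[OF fA fz] K by (simp add: sum_nonneg)
qed

theorem mainTheorem3:
  fixes Q :: "complex \<Rightarrow> real"
  assumes "C2_smooth Q"
    and "\<exists>\<epsilon>>0. \<exists>C0>0. \<forall>z. cmod z \<ge> C0 \<longrightarrow> Q z \<ge> (1 + \<epsilon>) * ln ((cmod z)\<^sup>2)"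
  shows "\<exists>C::real. \<forall>(z::complex) (m::real) (n::nat). m \<ge> 1 \<longrightarrow> n \<ge> 1 \<longrightarrow> real n \<le> m \<longrightarrow>
           Re (K2 m Q n z z) * exp (- m * Q z)
             \<le> C * m\<^sup>2 * exp (- m * (Q z - real_of_ereal (equilibrium_weight Q z)))"
proof -
  have cQ: "continuous_on UNIV Q" by (rule C2_smooth_continuous) fact
  obtain \<epsilon> C0 where growth: "\<epsilon> > 0" "\<And>z. cmod z \<ge> C0 \<Longrightarrow> Q z \<ge> (1 + \<epsilon>) * ln ((cmod z)\<^sup>2)"
    using assms(2) by blast
  obtain R :: real where R: "R \<ge> 1"
    and poly_le: "\<And>m p A z. m \<ge> 1 \<Longrightarrow> real (degree p) \<le> m \<Longrightarrow> A > 0 \<Longrightarrow>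
       (\<And>z. cmod z \<le> R \<Longrightarrow> (cmod (poly p z))\<^sup>2 \<le> A * exp (m * Q z)) \<Longrightarrow>
       (cmod (poly p z))\<^sup>2 \<le> A * exp (m * real_of_ereal (equilibrium_weight Q z))"
    using poly_le_exp_equilibrium_weight[OF cQ growth] by blast
  obtain C1 :: real where C1: "C1 > 0"
    and local: "\<And>m a f1 f2 N. m \<ge> 1 \<Longrightarrow> cmod a \<le> R \<Longrightarrow> f1 holomorphic_on UNIV \<Longrightarrow> f2 holomorphic_on UNIV \<Longrightarrow> N \<ge> 0 \<Longrightarrow>
      (\<integral>\<^sup>+w. ennreal ((cmod (f1 w + cnj w * f2 w))\<^sup>2 * exp (- m * Q w)) \<partial>lborel) \<le> ennreal N \<Longrightarrow>
      (cmod (f1 a + cnj a * f2 a))\<^sup>2 + (cmod (f2 a))\<^sup>2 / m \<le> C1 * m * exp (m * Q a) * N"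
    using bianalytic_weighted_pointwise[OF assms(1), of R] by blast
  define D where "D = (2 + 2 * R\<^sup>2) * (C1 * pi)"
  have D: "D > 0" unfolding D_def using C1 by (intro mult_pos_pos) (auto intro: add_pos_nonneg)
  have "Re (K2 m Q n z z) \<le> 4 * D * m\<^sup>2 * exp (m * real_of_ereal (equilibrium_weight Q z))"
    if m: "m \<ge> 1" and n: "n \<ge> 1" and nm: "real n \<le> m" for z m n
  proof -
    define k where "k = Re (K2 m Q n z z)"
    obtain f where fA: "f \<in> A2 m Q n" and fz: "f z = of_real k" and k0: "k \<ge> 0"
      and norm_f: "(\<integral>w. (cmod (f w))\<^sup>2 \<partial>weighted_dA m Q) = k"
      using kernel_extremal_function[OF cQ, of m n z] by (metis complex_is_Real_iff k_def of_real_Re)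
    obtain p q where deg: "degree p < n" "degree q < n" and f: "\<And>z. f z = poly p z + cnj z * poly q z"
      using Pol2_poly[OF _ n, of f] fA by (auto simp: A2_def)
    show ?thesis
    proof (cases "k = 0")
      case True
      then show ?thesis using D by (simp add: k_def)
    next
      case False
      then have k: "k > 0" using k0 by simp
      define A where "A = D * m\<^sup>2 * k"
      have A: "A > 0" unfolding A_def using D m k by simp
      have cf: "continuous_on UNIV (\<lambda>w. (cmod (f w))\<^sup>2)"
        using fA by (auto simp: A2_def intro!: continuous_intros Pol2_continuous)
      have "(\<integral>\<^sup>+w. ennreal ((cmod (f w))\<^sup>2 * exp (- m * Q w)) \<partial>lborel) = ennreal (pi * k)"
        using nn_integral_weighted_dA[OF cQ cf, of m] fA norm_f by (simp add: A2_def L2_def)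
      then have int: "(\<integral>\<^sup>+w. ennreal ((cmod (poly p w + cnj w * poly q w))\<^sup>2 * exp (- m * Q w)) \<partial>lborel) \<le> ennreal (pi * k)"
        by (simp add: f)
      have pq: "2 * (cmod (f a))\<^sup>2 + 2 * R\<^sup>2 * (cmod (poly q a))\<^sup>2 \<le> A * exp (m * Q a)" if a: "cmod a \<le> R" for a
      proof -
        define T where "T = C1 * m * exp (m * Q a) * (pi * k)"
        have T: "T \<ge> 0" unfolding T_def using C1 m k by simp
        have sum: "(cmod (f a))\<^sup>2 + (cmod (poly q a))\<^sup>2 / m \<le> T"
          unfolding T_def f using k by (intro local m a int holomorphic_intros) auto
        have "0 \<le> (cmod (poly q a))\<^sup>2 / m" "0 \<le> (cmod (f a))\<^sup>2" using m by auto
        then have 1: "(cmod (f a))\<^sup>2 \<le> T" and 2: "(cmod (poly q a))\<^sup>2 / m \<le> T" using sum by linarith+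
        have "(cmod (poly q a))\<^sup>2 \<le> m * T" using 2 m by (simp add: field_simps)
        moreover have "(cmod (f a))\<^sup>2 \<le> m * T" using 1 mult_right_mono[OF m T] by simp
        ultimately have "2 * (cmod (f a))\<^sup>2 + 2 * R\<^sup>2 * (cmod (poly q a))\<^sup>2 \<le> 2 * (m * T) + 2 * R\<^sup>2 * (m * T)"
          by (intro add_mono mult_left_mono) auto
        also have "\<dots> = A * exp (m * Q a)"
          by (simp add: T_def A_def D_def power2_eq_square algebra_simps)
        finally show ?thesis .
      qed
      have "(cmod (poly p z))\<^sup>2 \<le> A * exp (m * real_of_ereal (equilibrium_weight Q z))"
      proof (rule poly_le[OF m _ A])
        show "real (degree p) \<le> m" using deg(1) nm by linarith
        fix a assume a: "cmod a \<le> R"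
        have "poly p a = f a - cnj a * poly q a" by (simp add: f)
        then have "cmod (poly p a) \<le> cmod (f a) + cmod a * cmod (poly q a)"
          by (metis norm_triangle_ineq4 norm_mult complex_mod_cnj)
        also have "\<dots> \<le> cmod (f a) + R * cmod (poly q a)" using a by (intro add_left_mono mult_right_mono) auto
        finally have "(cmod (poly p a))\<^sup>2 \<le> (cmod (f a) + R * cmod (poly q a))\<^sup>2" by (intro power_mono) auto
        also have "\<dots> \<le> 2 * (cmod (f a))\<^sup>2 + 2 * (R * cmod (poly q a))\<^sup>2"
          using sum_squares_bound[of "cmod (f a)" "R * cmod (poly q a)"] by (simp add: power2_sum)
        also have "\<dots> \<le> A * exp (m * Q a)" using pq[OF a] by (simp add: power_mult_distrib)
        finally show "(cmod (poly p a))\<^sup>2 \<le> A * exp (m * Q a)" .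
      qed
      moreover have "(cmod (poly (pCons 0 q) z))\<^sup>2 \<le> A * exp (m * real_of_ereal (equilibrium_weight Q z))"
      proof (rule poly_le[OF m _ A])
        have "degree (pCons 0 q) \<le> Suc (degree q)" by (rule degree_pCons_le)
        then show "real (degree (pCons 0 q)) \<le> m" using deg(2) nm by linarith
        fix a assume a: "cmod a \<le> R"
        have "(cmod (poly (pCons 0 q) a))\<^sup>2 = (cmod a)\<^sup>2 * (cmod (poly q a))\<^sup>2"
          by (simp add: norm_mult power_mult_distrib)
        also have "\<dots> \<le> R\<^sup>2 * (cmod (poly q a))\<^sup>2" using a by (intro mult_right_mono power_mono) auto
        also have "\<dots> \<le> 2 * (cmod (f a))\<^sup>2 + 2 * R\<^sup>2 * (cmod (poly q a))\<^sup>2" by simp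
        also have "\<dots> \<le> A * exp (m * Q a)" by (rule pq[OF a])
        finally show "(cmod (poly (pCons 0 q) a))\<^sup>2 \<le> A * exp (m * Q a)" .
      qed
      moreover have "k\<^sup>2 \<le> 2 * (cmod (poly p z))\<^sup>2 + 2 * (cmod (poly (pCons 0 q) z))\<^sup>2"
      proof -
        \<comment> \<open>The factors \<open>cnj z\<close> and \<open>z\<close> have the same modulus.\<close>
        have "k = cmod (poly p z + cnj z * poly q z)" using fz f[of z] k by simp
        also have "\<dots> \<le> cmod (poly p z) + cmod (poly (pCons 0 q) z)"
          using norm_triangle_ineq[of "poly p z" "cnj z * poly q z"] by (simp add: norm_mult)
        finally have "k\<^sup>2 \<le> (cmod (poly p z) + cmod (poly (pCons 0 q) z))\<^sup>2" using k by (intro power_mono) auto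
        also have "\<dots> \<le> 2 * (cmod (poly p z))\<^sup>2 + 2 * (cmod (poly (pCons 0 q) z))\<^sup>2"
          using sum_squares_bound[of "cmod (poly p z)" "cmod (poly (pCons 0 q) z)"] by (simp add: power2_sum)
        finally show ?thesis .
      qed
      ultimately have "k\<^sup>2 \<le> 4 * A * exp (m * real_of_ereal (equilibrium_weight Q z))" by linarith
      then have "k * k \<le> k * (4 * D * m\<^sup>2 * exp (m * real_of_ereal (equilibrium_weight Q z)))"
        by (simp add: A_def power2_eq_square mult_ac)
      then have "k \<le> 4 * D * m\<^sup>2 * exp (m * real_of_ereal (equilibrium_weight Q z))"
        using k by (rule mult_left_le_imp_le)
      then show ?thesis by (simp add: k_def)
    qed
  qed
  then have bound: "Re (K2 m Q n z z) * exp (- m * Q z)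
      \<le> 4 * D * m\<^sup>2 * exp (m * real_of_ereal (equilibrium_weight Q z)) * exp (- m * Q z)"
    if "m \<ge> 1" "n \<ge> 1" "real n \<le> m" for z m n
    using that by (intro mult_right_mono) auto
  have "exp (m * real_of_ereal (equilibrium_weight Q z)) * exp (- m * Q z)
     = exp (- m * (Q z - real_of_ereal (equilibrium_weight Q z)))" for m z
    by (simp add: right_diff_distrib flip: exp_add)
  then show ?thesis
    using bound by (intro exI[of _ "4 * D"] allI impI) (simp only: mult.assoc)
qed

end
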